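(* Let $N\ge1$ and $0<p<q<\infty$. There exists a constant $C=C(p,q,N)$, depending only on $p,q,N$ (and not on $s$), such that for every $s\in(0,1)$ and every $u\in BMO(\mathbb{R}^N)$, $$\|u\|_{W^{\frac{ps}{q},q}(\mathbb{R}^N)}\le C\,[u]_{W^{s,p}_w(\mathbb{R}^N)}^{\frac pq}\,\|u\|_{BMO(\mathbb{R}^N)}^{1-\frac pq}\le C\,\|u\|_{W^{s,p}(\mathbb{R}^N)}^{\frac pq}\,\|u\|_{BMO(\mathbb{R}^N)}^{1-\frac pq}$$ (inequalities in $[0,\infty]$). In particular, if $u\in W^{s,p}_w(\mathbb{R}^N)\cap BMO(\mathbb{R}^N)$, then $u\in W^{\frac{ps}{q},q}(\mathbb{R}^N)$.
   Context: $\mathcal{L}^N$ is Lebesgue measure; $0\cdot\infty:=0$. For $0<q<\infty$, $s\in(0,1)$ and measurable $u:\mathbb{R}^N\to\mathbb{R}$, the Gagliardo quasi-seminorm is $$\|u\|_{W^{s,q}(\mathbb{R}^N)}:=\left(\int_{\mathbb{R}^N}\int_{\mathbb{R}^N}\frac{|u(x)-u(z)|^q}{|x-z|^{sq+N}}dx\,dz\right)^{1/q},$$ and $u\in W^{s,q}(\mathbb{R}^N)$ iff $u\in L^q(\mathbb{R}^N)$ and this is finite. The weak version is $$[u]_{W^{s,q}_w(\mathbb{R}^N)}:=\sup_{0<t<\infty}\left(\int_{\mathbb{R}^N}t\,\mathcal{L}^N\big(\{x\in\mathbb{R}^N:|u(x+y)-u(x)|^q>t\}\big)\frac{1}{|y|^{sq+N}}dy\right)^{1/q},$$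 and $u\in W^{s,q}_w(\mathbb{R}^N)$ iff $u\in L^q_w(\mathbb{R}^N)$ (i.e. $\sup_{t>0}t\,\mathcal{L}^N(\{|u|^q>t\})<\infty$) and $[u]_{W^{s,q}_w(\mathbb{R}^N)}<\infty$. A cube is a Cartesian product of $N$ non-empty closed bounded intervals of the same (positive) length. For $u\in L^1_{\mathrm{loc}}(\mathbb{R}^N)$, $u\in BMO(\mathbb{R}^N)$ means that $$\|u\|_{BMO(\mathbb{R}^N)}:=\sup\left\{\frac{1}{\mathcal{L}^N(C)^2}\int_C\int_C|u(z)-u(x)|\,dz\,dx : C\subset \mathbb{R}^N\text{ a cube}\right\}<\infty .$$ *)

theory Defs
  imports "HOL-Analysis.Analysis"
begin

text \<open>Real powers on \<open>[0, \<infinity>]\<close>; the convention \<open>\<infinity>\<^bsup>a\<^esup> = \<infinity>\<close> is only meaningful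
  for \<open>a > 0\<close>, the only case used here.\<close>

definition ennreal_powr :: "ennreal \<Rightarrow> real \<Rightarrow> ennreal"  (infixr "epowr" 80) where
  "x epowr a = (if x = \<infinity> then \<infinity> else ennreal (enn2real x powr a))"

definition Lp_space :: "real \<Rightarrow> ((real ^ 'n) \<Rightarrow> real) set" where
  "Lp_space q = {u \<in> borel_measurable lebesgue. (\<integral>\<^sup>+x. ennreal (\<bar>u x\<bar> powr q) \<partial>lebesgue) < \<infinity>}"

definition weak_Lp_space :: "real \<Rightarrow> ((real ^ 'n) \<Rightarrow> real) set" where
  "weak_Lp_space q = {u \<in> borel_measurable lebesgue.
     (SUP t\<in>{0<..}. ennreal t * emeasure lebesgue {x. \<bar>u x\<bar> powr q > t}) < \<infinity>}"

text \<open>In the two definitions below the kernel takes the value \<open>0\<close> instead of \<open>\<infinity>\<close> on the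
  diagonal (since \<open>a / 0 = 0\<close>); the diagonal is a null set.\<close>

definition gagliardo_norm :: "real \<Rightarrow> real \<Rightarrow> ((real ^ 'n) \<Rightarrow> real) \<Rightarrow> ennreal" where
  "gagliardo_norm s q u =
     (\<integral>\<^sup>+z. (\<integral>\<^sup>+x. ennreal (\<bar>u x - u z\<bar> powr q / norm (x - z) powr (s * q + real CARD('n)))
        \<partial>lebesgue) \<partial>lebesgue) epowr (1 / q)"

definition weak_gagliardo_norm :: "real \<Rightarrow> real \<Rightarrow> ((real ^ 'n) \<Rightarrow> real) \<Rightarrow> ennreal" where
  "weak_gagliardo_norm s q u =
     (SUP t\<in>{0<..}.
        (\<integral>\<^sup>+y. ennreal t * emeasure lebesgue {x. \<bar>u (x + y) - u x\<bar> powr q > t}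
              * ennreal (1 / norm y powr (s * q + real CARD('n))) \<partial>lebesgue) epowr (1 / q))"

definition Wsq_space :: "real \<Rightarrow> real \<Rightarrow> ((real ^ 'n) \<Rightarrow> real) set" where
  "Wsq_space s q = {u \<in> Lp_space q. gagliardo_norm s q u < \<infinity>}"

definition weak_Wsq_space :: "real \<Rightarrow> real \<Rightarrow> ((real ^ 'n) \<Rightarrow> real) set" where
  "weak_Wsq_space s q = {u \<in> weak_Lp_space q. weak_gagliardo_norm s q u < \<infinity>}"

definition cubes :: "(real ^ 'n) set set" where
  "cubes = {cbox a b | a b. \<exists>l>0. \<forall>i. b $ i - a $ i = l}"

definition L1_loc :: "((real ^ 'n) \<Rightarrow> real) set" where
  "L1_loc = {u \<in> borel_measurable lebesgue. \<forall>K. compact K \<longrightarrow> u absolutely_integrable_on K}"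

definition BMO_norm :: "((real ^ 'n) \<Rightarrow> real) \<Rightarrow> ennreal" where
  "BMO_norm u =
     (SUP C\<in>cubes. 1 / (emeasure lebesgue C)\<^sup>2 *
        (\<integral>\<^sup>+x\<in>C. (\<integral>\<^sup>+z\<in>C. ennreal \<bar>u z - u x\<bar> \<partial>lebesgue) \<partial>lebesgue))"

definition BMO :: "((real ^ 'n) \<Rightarrow> real) set" where
  "BMO = {u \<in> L1_loc. BMO_norm u < \<infinity>}"

end

theory Submission
  imports Defs
begin

text \<open>
  Write \<open>U(x, z) = |u x - u z|\<close>, \<open>B = \<parallel>u\<parallel>\<^bsub>BMO\<^esub>\<close> and let \<open>\<mu>\<close> be the measure
  \<open>|x - z|\<^bsup>-sp-N\<^esup> dx dz\<close>. The weak quasi-seminorm bounds \<open>\<lambda>\<^sup>p \<mu>(U > \<lambda>)\<close>, and so by summing over dyadic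
  levels it bounds \<open>\<integral> min(U, b)\<^sup>q d\<mu>\<close> by a multiple of \<open>[u]\<^sup>p b\<^bsup>q-p\<^esup>\<close>. It remains to
  show \<open>\<integral> U\<^sup>q d\<mu> \<le> C \<integral> min(U, b)\<^sup>q d\<mu>\<close> for \<open>b\<close> a large multiple of \<open>B\<close>. The kernel
  \<open>|x - z|\<^bsup>-sp-N\<^esup>\<close> is comparable to a superposition of the functions \<open>1\<^bsub>Q\<times>Q\<^esub>\<close> over all cubes
  \<open>Q\<close>, with constants uniform in \<open>s\<close>, so the inequality is only needed on \<open>Q \<times> Q\<close> with respect to
  Lebesgue measure. There it follows from a good-lambda inequality,
  \<open>|{x \<in> Q. |u x - c| > \<lambda> + K B}| \<le> \<epsilon> |{x \<in> Q. |u x - c| > \<lambda>}|\<close> as soon as the set on the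
  right fills at most half of \<open>Q\<close>. It is proved by stopping cubes and the Vitali covering lemma.
\<close>

section \<open>Centred cubes\<close>

text \<open>The order \<open>p * s / q\<close> is the one for which
  \<open>p * s / q * q = p * s\<close>, so both quasi-seminorms integrate against the same kernel.
  The weak quasi-seminorm gives level sets decaying like \<lambda>^(-p), and the integral of
  \<lambda>^(q-p-1) converges at 0 but diverges at infinity because p < q: BMO has to supply the
  high levels. Exponential decay in the style of John and Nirenberg is not enough by itself, since
  its bound on a cube is proportional to the measure of the cube, and such bounds have a divergent
  superposition over all cubes. Hence the high levels are estimated by lower levels of the same
  function on the same cube, an inequality that survives superposition. Uniformity in s rests on the
  kernel exponent lying between N and N + p. The truncation level is a multiple of B and must be
  positive, so B = 0 is a separate case. A Lebesgue measurable u is replaced by a Borel function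
  equal to it almost everywhere, because Tonelli over pairs of points and over cubes needs joint
  measurability.\<close>

definition ccube :: "real ^ 'n \<Rightarrow> real \<Rightarrow> (real ^ 'n) set" where
  "ccube a r = {x. \<forall>i. \<bar>x $ i - a $ i\<bar> \<le> r}"

lemma ccube_eq_cbox: "ccube a r = cbox (\<chi> i. a $ i - r) (\<chi> i. a $ i + r)"
  unfolding ccube_def by (auto simp: mem_box_cart abs_le_iff algebra_simps)

lemma ccube_borel [measurable]: "ccube a r \<in> sets borel"
  by (simp add: ccube_eq_cbox)

lemma mem_ccube_self: "0 \<le> r \<Longrightarrow> a \<in> ccube a r"
  by (simp add: ccube_def)

lemma ccube_mono: "r \<le> r' \<Longrightarrow> ccube a r \<subseteq> ccube a r'"
  unfolding ccube_def by (auto intro: order_trans)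

lemma mem_ccube_commute: "x \<in> ccube a r \<longleftrightarrow> a \<in> ccube x r"
  by (simp add: ccube_def abs_minus_commute)

lemma emeasure_ccube:
  fixes a :: "real ^ 'n"
  assumes "0 \<le> r"
  shows "emeasure lborel (ccube a r) = ennreal ((2 * r) ^ CARD('n))"
proof -
  have ne: "cbox (\<chi> i. a $ i - r) (\<chi> i. a $ i + r) \<noteq> {}"
    using mem_ccube_self[OF assms, of a] by (auto simp: ccube_eq_cbox)
  have "measure lborel (ccube a r) = (2 * r) ^ CARD('n)"
    unfolding ccube_eq_cbox content_cbox_cart[OF ne] by (simp add: algebra_simps)
  then show ?thesis
    unfolding ccube_eq_cbox using emeasure_lborel_cbox_finite[of "\<chi> i. a $ i - r" "\<chi> i. a $ i + r"]
    by (subst emeasure_eq_ennreal_measure) auto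
qed

lemma ccube_in_cubes: "0 < r \<Longrightarrow> ccube a r \<in> cubes"
  unfolding cubes_def ccube_eq_cbox by (auto intro!: exI exI[of _ "2 * r"])

lemma cball_subset_ccube: "cball x r \<subseteq> ccube x r"
proof
  fix y assume "y \<in> cball x r"
  then have "norm (y - x) \<le> r" by (simp add: dist_norm norm_minus_commute)
  then show "y \<in> ccube x r"
    unfolding ccube_def using component_le_norm_cart[of "y - x"] by (auto intro: order_trans)
qed

lemma norm_le_ccube:
  fixes x y :: "real ^ 'n"
  assumes "y \<in> ccube x h" "0 \<le> h"
  shows "norm (y - x) \<le> sqrt CARD('n) * h"
proof -
  have "norm (y - x) \<le> sqrt DIM(real ^ 'n) * infnorm (y - x)"
    by (rule norm_le_infnorm)
  also have "infnorm (y - x) \<le> h"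
    unfolding infnorm_def
    by (rule cSup_least) (use assms in \<open>auto simp: ccube_def Basis_vec_def inner_axis\<close>)
  finally show ?thesis by (simp add: mult_left_mono)
qed

lemma ccube_subset_cball:
  fixes x :: "real ^ 'n"
  assumes "0 \<le> h"
  shows "ccube x h \<subseteq> cball x (sqrt CARD('n) * h)"
  using norm_le_ccube[OF _ assms, of _ x] by (auto simp: dist_norm norm_minus_commute)

text \<open>Shifting \<open>x\<close> towards \<open>a\<close> by at most \<open>h\<close> in each
  coordinate leaves room \<open>h\<close> inside the big cube. So even a cube around a boundary
  point of \<open>ccube a r\<close> has a fixed share inside \<open>ccube a r\<close>.\<close>

lemma ccube_inter_contains:
  fixes a x :: "real ^ 'n"
  assumes "x \<in> ccube a r" "0 \<le> h" "h \<le> r"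
  obtains y where "ccube y h \<subseteq> ccube x (2 * h) \<inter> ccube a r"
proof -
  define t where "t i = max (- h) (min h (a $ i - x $ i))" for i
  define y :: "real ^ 'n" where "y = (\<chi> i. x $ i + t i)"
  have 1: "\<bar>y $ i - x $ i\<bar> \<le> h" for i
    unfolding y_def t_def using assms by auto
  have 2: "\<bar>y $ i - a $ i\<bar> \<le> r - h" for i
  proof -
    have "\<bar>x $ i - a $ i\<bar> \<le> r" using assms by (auto simp: ccube_def)
    then show ?thesis unfolding y_def t_def using assms by auto
  qed
  have "\<bar>z $ i - x $ i\<bar> \<le> 2 * h \<and> \<bar>z $ i - a $ i\<bar> \<le> r" if "\<bar>z $ i - y $ i\<bar> \<le> h" for z i
    using 1[of i] 2[of i] that by linarith
  then have "ccube y h \<subseteq> ccube x (2 * h) \<inter> ccube a r"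
    unfolding ccube_def by auto
  then show ?thesis by (rule that)
qed

text \<open>Lebesgue density on the one-sided cube from \<open>x\<close> to
  \<open>x + h *\<^sub>R One\<close>, which lies in \<open>ccube x h\<close>: eventually more than
  half of it belongs to \<open>E\<close>. The threshold therefore refers to its volume
  \<open>h ^ CARD('n)\<close> and not to the volume of the centred cube.\<close>

lemma density_ccube:
  fixes E :: "(real ^ 'n) set"
  assumes [measurable]: "E \<in> sets borel"
  shows "AE x in lborel. x \<in> E \<longrightarrow>
    (\<exists>d>0. \<forall>h. 0 < h \<and> h < d \<longrightarrow> ennreal (h ^ CARD('n) / 2) < emeasure lborel (E \<inter> ccube x h))"
proof -
  let ?f = "indicator E :: real ^ 'n \<Rightarrow> real"
  have lm: "E \<inter> cbox a b \<in> lmeasurable" for a b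
    by (rule bounded_set_imp_lmeasurable) (auto intro: bounded_Int)
  have int: "?f integrable_on cbox a b" and val: "integral (cbox a b) ?f = measure lborel (E \<inter> cbox a b)" for a b
  proof -
    have *: "(\<lambda>x. if x \<in> cbox a b then ?f x else 0) = indicator (E \<inter> cbox a b)"
      by (auto simp: indicator_def)
    have "((\<lambda>x. indicator (E \<inter> cbox a b) x :: real) has_integral measure lebesgue (E \<inter> cbox a b)) UNIV"
      using lm[of a b] lmeasurable_iff_has_integral by blast
    then have "(?f has_integral measure lebesgue (E \<inter> cbox a b)) (cbox a b)"
      unfolding has_integral_restrict_UNIV[of "cbox a b" ?f, symmetric] * .
    then show "?f integrable_on cbox a b" "integral (cbox a b) ?f = measure lborel (E \<inter> cbox a b)"
      by (auto simp: integral_unique has_integral_integrable measure_completion)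
  qed
  obtain N where N: "negligible N" and d: "\<And>x e. \<lbrakk>x \<notin> N; 0 < e\<rbrakk> \<Longrightarrow>
       \<exists>d>0. \<forall>h. 0 < h \<and> h < d \<longrightarrow>
         norm (integral (cbox x (x + h *\<^sub>R One)) ?f /\<^sub>R h ^ DIM(real ^ 'n) - ?f x) < e"
    using integrable_ccontinuous_explicit[OF int] by blast
  have "AE x in lebesgue. x \<notin> N"
    using N by (simp add: AE_not_in negligible_iff_null_sets)
  then have "AE x in lborel. x \<notin> N" by (simp add: AE_completion_iff)
  then show ?thesis
  proof eventually_elim
    case (elim x)
    show ?case
    proof
      assume xE: "x \<in> E"
      obtain \<delta> where "\<delta> > 0" and \<delta>: "\<And>h. 0 < h \<Longrightarrow> h < \<delta> \<Longrightarrow>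
         norm (integral (cbox x (x + h *\<^sub>R One)) ?f /\<^sub>R h ^ DIM(real ^ 'n) - ?f x) < 1/2"
        using d[OF elim, of "1/2"] by auto
      have "ennreal (h ^ CARD('n) / 2) < emeasure lborel (E \<inter> ccube x h)" if h: "0 < h" "h < \<delta>" for h
      proof -
        let ?m = "measure lborel (E \<inter> cbox x (x + h *\<^sub>R One))"
        have "\<bar>?m / h ^ CARD('n) - 1\<bar> < 1/2"
        proof -
          have "norm (?m /\<^sub>R h ^ CARD('n) - 1) < 1/2"
            using \<delta>[OF h] xE unfolding val DIM_cart by simp
          then show ?thesis by (metis divide_inverse_commute real_norm_def real_scaleR_def)
        qed
        then have "1/2 < ?m / h ^ CARD('n)" by linarith
        then have *: "h ^ CARD('n) / 2 < ?m" using h by (simp add: field_simps)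
        have fin: "emeasure lborel (E \<inter> cbox x (x + h *\<^sub>R One)) \<noteq> \<infinity>"
          using lm[of x "x + h *\<^sub>R One"] by (auto simp: fmeasurable_def)
        have "ennreal (h ^ CARD('n) / 2) < ennreal ?m"
          using * h by (simp add: ennreal_less_iff)
        also have "\<dots> = emeasure lborel (E \<inter> cbox x (x + h *\<^sub>R One))"
          using fin by (simp add: emeasure_eq_ennreal_measure)
        also have "\<dots> \<le> emeasure lborel (E \<inter> ccube x h)"
        proof (rule emeasure_mono)
          have "(One :: real ^ 'n) $ i = 1" for i
            by (simp add: cart_eq_inner_axis inner_sum_left_Basis axis_in_Basis_iff)
          then show "E \<inter> cbox x (x + h *\<^sub>R One) \<subseteq> E \<inter> ccube x h"
            using h by (auto simp: ccube_def mem_box_cart abs_le_iff algebra_simps)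
              (smt (verit, best))+
        qed auto
        finally show ?thesis .
      qed
      then show "\<exists>d>0. \<forall>h. 0 < h \<and> h < d \<longrightarrow> ennreal (h ^ CARD('n) / 2) < emeasure lborel (E \<inter> ccube x h)"
        using \<open>\<delta> > 0\<close> by blast
    qed
  qed
qed

section \<open>The good-lambda inequality\<close>

text \<open>The BMO bound with denominators cleared and a real constant, so that later estimates use
  real arithmetic instead of division in \<open>ennreal\<close>.\<close>

definition bmo_bounded :: "real \<Rightarrow> (real ^ 'n \<Rightarrow> real) \<Rightarrow> bool" where
  "bmo_bounded B v \<longleftrightarrow> (\<forall>a r. 0 < r \<longrightarrow>
     (\<integral>\<^sup>+x\<in>ccube a r. (\<integral>\<^sup>+z\<in>ccube a r. ennreal \<bar>v z - v x\<bar> \<partial>lborel) \<partial>lborel)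
       \<le> ennreal (B * ((2 * r) ^ CARD('n))\<^sup>2))"

lemma emeasure_UN_le_nn_integral_count_space:
  assumes "countable I" and [measurable]: "\<And>i. i \<in> I \<Longrightarrow> X i \<in> sets M"
  shows "emeasure M (\<Union>i\<in>I. X i) \<le> (\<integral>\<^sup>+i. emeasure M (X i) \<partial>count_space I)"
proof -
  have [measurable]: "(\<Union>i\<in>I. X i) \<in> sets M"
    using assms by (intro sets.countable_UN'') auto
  have "emeasure M (\<Union>i\<in>I. X i) = (\<integral>\<^sup>+x. indicator (\<Union>i\<in>I. X i) x \<partial>M)"
    by simp
  also have "\<dots> \<le> (\<integral>\<^sup>+x. \<integral>\<^sup>+i. indicator (X i) x \<partial>count_space I \<partial>M)"
  proof (rule nn_integral_mono)
    fix x
    show "indicator (\<Union>i\<in>I. X i) x \<le> (\<integral>\<^sup>+i. indicator (X i) x \<partial>count_space I :: ennreal)"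
    proof (cases "x \<in> (\<Union>i\<in>I. X i)")
      case True
      then obtain j where j: "j \<in> I" "x \<in> X j" by auto
      have "(indicator (X j) x :: ennreal) \<le> (\<integral>\<^sup>+i. indicator (X i) x \<partial>count_space I)"
        using j by (intro nn_integral_ge_point)
      with True j show ?thesis by simp
    qed simp
  qed
  also have "\<dots> = (\<integral>\<^sup>+i. \<integral>\<^sup>+x. indicator (X i) x \<partial>M \<partial>count_space I)"
    by (rule nn_integral_count_space_nn_integral) (use assms in auto)
  also have "\<dots> = (\<integral>\<^sup>+i. emeasure M (X i) \<partial>count_space I)"
    by (rule nn_integral_cong) simp
  finally show ?thesis .
qed

text \<open>\<open>E\<close> takes at most half the volume of the cube \<open>ccube y h\<close>
  found inside \<open>ccube a r\<close>, so \<open>G\<close>, the rest of that cube, has at least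
  the other half. Between \<open>G\<close> and the level set \<open>S\<close> the function jumps by
  at least \<open>K * B\<close>; the mean oscillation on \<open>ccube x H\<close> then bounds
  \<open>K * B * |S| * |G|\<close> by \<open>B\<close> times the squared volume. \<open>H\<close> is
  separate from \<open>h\<close> because \<open>S\<close> must reach over the Vitali enlargement of
  the stopping cube.\<close>

lemma emeasure_level_set_ccube_le:
  fixes v :: "real ^ 'n \<Rightarrow> real"
  assumes [measurable]: "v \<in> borel_measurable borel" "E \<in> sets borel"
    and bmo: "bmo_bounded B v" "0 < B" and "0 < K"
    and x: "x \<in> ccube a r" "0 < h" "h \<le> r" "2 * h \<le> H"
    and E: "emeasure lborel (E \<inter> ccube x (2 * h)) \<le> ennreal ((2 * h) ^ CARD('n) / 2)"
    and lam: "\<And>z. z \<in> ccube a r \<Longrightarrow> z \<notin> E \<Longrightarrow> \<bar>v z - c\<bar> \<le> l"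
  shows "emeasure lborel {z \<in> ccube x H. l + K * B < \<bar>v z - c\<bar>}
    \<le> ennreal (2 * ((2 * H) ^ CARD('n))\<^sup>2 / (K * (2 * h) ^ CARD('n)))"
proof -
  let ?n = "CARD('n)"
  obtain y where y: "ccube y h \<subseteq> ccube x (2 * h) \<inter> ccube a r"
    using ccube_inter_contains[of x a r h] x by auto
  define G where "G = ccube y h - E"
  define S where "S = {z \<in> ccube x H. l + K * B < \<bar>v z - c\<bar>}"
  have [measurable]: "G \<in> sets borel" "S \<in> sets borel"
    unfolding G_def S_def by measurable
  have S_le: "emeasure lborel S \<le> ennreal ((2 * H) ^ ?n)"
    using emeasure_mono[of S "ccube x H" lborel] emeasure_ccube[of H x] x by (auto simp: S_def)
  then obtain s where s: "emeasure lborel S = ennreal s" "0 \<le> s"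
    by (metis ennreal_cases ennreal_less_top infinity_ennreal_def linorder_not_less)
  have G_ge: "ennreal ((2 * h) ^ ?n / 2) \<le> emeasure lborel G"
  proof -
    have "ennreal ((2 * h) ^ ?n) = emeasure lborel (ccube y h)"
      using emeasure_ccube[of h y] x by simp
    also have "\<dots> \<le> emeasure lborel (G \<union> (E \<inter> ccube x (2 * h)))"
      by (rule emeasure_mono) (use y in \<open>auto simp: G_def\<close>)
    also have "\<dots> \<le> emeasure lborel G + emeasure lborel (E \<inter> ccube x (2 * h))"
      by (rule emeasure_subadditive) auto
    also have "\<dots> \<le> emeasure lborel G + ennreal ((2 * h) ^ ?n / 2)"
      by (rule add_left_mono[OF E])
    finally have "ennreal ((2 * h) ^ ?n / 2) + ennreal ((2 * h) ^ ?n / 2)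
        \<le> emeasure lborel G + ennreal ((2 * h) ^ ?n / 2)"
      using x by (subst ennreal_plus[symmetric]) (auto simp: mult.commute)
    then show ?thesis
      by (metis add.commute ennreal_add_left_cancel_le ennreal_neq_top infinity_ennreal_def)
  qed
  have GH: "G \<subseteq> ccube x H"
    using y ccube_mono[OF \<open>2 * h \<le> H\<close>, of x] by (auto simp: G_def)
  have SH: "S \<subseteq> ccube x H" by (auto simp: S_def)
  have dist: "K * B \<le> \<bar>v z - v w\<bar>" if "z \<in> S" "w \<in> G" for z w
  proof -
    have "\<bar>v w - c\<bar> \<le> l" using lam[of w] that y by (auto simp: G_def)
    moreover have "l + K * B < \<bar>v z - c\<bar>" using that by (auto simp: S_def)
    ultimately show ?thesis by linarith
  qed
  have "ennreal (K * B) * emeasure lborel S * emeasure lborel G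
      = (\<integral>\<^sup>+w\<in>G. (\<integral>\<^sup>+z\<in>S. ennreal (K * B) \<partial>lborel) \<partial>lborel)"
    by (simp add: nn_integral_cmult_indicator)
  also have "\<dots> \<le> (\<integral>\<^sup>+w\<in>ccube x H. (\<integral>\<^sup>+z\<in>ccube x H. ennreal \<bar>v z - v w\<bar> \<partial>lborel) \<partial>lborel)"
  proof (rule nn_integral_mono)
    fix w
    show "(\<integral>\<^sup>+z\<in>S. ennreal (K * B) \<partial>lborel) * indicator G w
      \<le> (\<integral>\<^sup>+z\<in>ccube x H. ennreal \<bar>v z - v w\<bar> \<partial>lborel) * indicator (ccube x H) w"
    proof (cases "w \<in> G")
      case True
      have "(\<integral>\<^sup>+z\<in>S. ennreal (K * B) \<partial>lborel) \<le> (\<integral>\<^sup>+z\<in>ccube x H. ennreal \<bar>v z - v w\<bar> \<partial>lborel)"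
        by (rule nn_integral_mono) (use SH dist[OF _ True] in \<open>auto simp: indicator_def intro!: ennreal_leI\<close>)
      then show ?thesis using True GH by auto
    qed auto
  qed
  also have "\<dots> \<le> ennreal (B * ((2 * H) ^ ?n)\<^sup>2)"
    using bmo x by (auto simp: bmo_bounded_def)
  finally have "ennreal (K * B) * emeasure lborel S * emeasure lborel G \<le> ennreal (B * ((2 * H) ^ ?n)\<^sup>2)" .
  then have "ennreal (K * B) * ennreal s * ennreal ((2 * h) ^ ?n / 2) \<le> ennreal (B * ((2 * H) ^ ?n)\<^sup>2)"
    using G_ge unfolding s(1) by (meson mult_left_mono order_trans zero_le)
  then have "ennreal (K * B * s * ((2 * h) ^ ?n / 2)) \<le> ennreal (B * ((2 * H) ^ ?n)\<^sup>2)"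
    using s \<open>0 < K\<close> bmo x by (simp only: ennreal_mult mult_nonneg_nonneg less_imp_le zero_le_power
        divide_nonneg_nonneg zero_le_numeral)
  then have "B * (K * s * ((2 * h) ^ ?n / 2)) \<le> B * ((2 * H) ^ ?n)\<^sup>2"
    using bmo by (subst (asm) ennreal_le_iff) (auto simp: ac_simps)
  then have "K * s * ((2 * h) ^ ?n / 2) \<le> ((2 * H) ^ ?n)\<^sup>2"
    using bmo by simp
  moreover have "0 < K * (2 * h) ^ ?n" using \<open>0 < K\<close> x by simp
  ultimately have "s \<le> 2 * ((2 * H) ^ ?n)\<^sup>2 / (K * (2 * h) ^ ?n)"
    by (subst pos_le_divide_eq) (auto simp: algebra_simps)
  then show ?thesis
    unfolding S_def[symmetric] s(1) by (rule ennreal_leI)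
qed

text \<open>The size of \<open>K\<close>: passing from a stopping cube of radius \<open>h\<close> to
  its ball and enlarging five times gives a cube of volume
  \<open>(10 * sqrt CARD('n)) ^ CARD('n) * h ^ CARD('n)\<close>. The oscillation bound squares this
  factor. Of the factor 4, one 2 comes from \<open>G\<close> filling only half a cube and the other
  from the density 1/2 of \<open>E\<close>.\<close>

lemma good_lambda_ccube:
  fixes v :: "real ^ 'n \<Rightarrow> real"
  assumes [measurable]: "v \<in> borel_measurable borel"
    and bmo: "bmo_bounded B v" "0 < B" and "0 < r" "0 < e"
    and K: "4 * ((10 * sqrt CARD('n)) ^ CARD('n))\<^sup>2 \<le> K * e"
    and half: "emeasure lborel {x \<in> ccube a r. l < \<bar>v x - c\<bar>} \<le> ennreal ((2 * r) ^ CARD('n) / 2)"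
  shows "emeasure lborel {x \<in> ccube a r. l + K * B < \<bar>v x - c\<bar>}
    \<le> ennreal e * emeasure lborel {x \<in> ccube a r. l < \<bar>v x - c\<bar>}"
proof -
  let ?n = "CARD('n)"
  define E where "E = {x \<in> ccube a r. l < \<bar>v x - c\<bar>}"
  have [measurable]: "E \<in> sets borel" unfolding E_def by measurable
  have n: "1 \<le> sqrt ?n" by simp
  have "0 < 4 * ((10 * sqrt ?n) ^ ?n)\<^sup>2" by simp
  with K have "0 < K * e" by linarith
  with \<open>0 < e\<close> have "0 < K" by (simp add: zero_less_mult_iff)
  \<comment> \<open>\<open>h\<close> stops at \<open>x\<close> if \<open>E\<close> is dense in the cube of radius \<open>h\<close> but leaves enough room in the
    doubled one: the former controls the cube by \<open>E\<close>, the latter makes the oscillation small.\<close>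
  define stop where "stop x h \<longleftrightarrow> 0 < h \<and> h \<le> r \<and> ennreal (h ^ ?n / 2) < emeasure lborel (E \<inter> ccube x h)
    \<and> emeasure lborel (E \<inter> ccube x (2 * h)) \<le> ennreal ((2 * h) ^ ?n / 2)" for x h
  define X where "X = {x \<in> E. \<exists>h. stop x h}"
  have AE_X: "AE x in lborel. x \<in> E \<longrightarrow> x \<in> X"
    using density_ccube[of E, simplified]
  proof eventually_elim
    case (elim x)
    show ?case
    proof
      assume xE: "x \<in> E"
      \<comment> \<open>The radii \<open>2 * r / 2 ^ k\<close> are tested from large to small.
        \<open>P 0\<close> fails because \<open>E\<close> fills at most half of
        \<open>ccube a r\<close>, and \<open>P k\<close> holds for some \<open>k\<close> by density.
        Where failure at \<open>m\<close> is followed by success at \<open>Suc m\<close>, the radius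
        with index \<open>Suc m\<close> satisfies both conditions of \<open>stop\<close>.\<close>
      define P where "P k \<longleftrightarrow> ennreal ((2 * r / 2 ^ k) ^ ?n / 2) < emeasure lborel (E \<inter> ccube x (2 * r / 2 ^ k))" for k :: nat
      obtain d where "d > 0" and d: "\<And>h. 0 < h \<Longrightarrow> h < d \<Longrightarrow> ennreal (h ^ ?n / 2) < emeasure lborel (E \<inter> ccube x h)"
        using elim xE by auto
      obtain k where "(1 / 2) ^ k < d / (2 * r)"
        using real_arch_pow_inv[of "d / (2 * r)" "1 / 2"] \<open>d > 0\<close> \<open>0 < r\<close> by auto
      then have "2 * r / 2 ^ k < d"
        using \<open>0 < r\<close> by (simp add: power_divide field_simps)
      then have "P k" unfolding P_def using \<open>0 < r\<close> by (intro d) auto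
      moreover have "\<not> P 0"
      proof -
        have "emeasure lborel (E \<inter> ccube x (2 * r)) \<le> emeasure lborel E"
          by (rule emeasure_mono) auto
        also have "\<dots> \<le> ennreal ((2 * r) ^ ?n / 2)" using half by (simp add: E_def)
        finally show ?thesis by (simp add: P_def not_less)
      qed
      ultimately obtain m where m: "\<not> P m" "P (Suc m)"
        using dec_induct[of 0 k "\<lambda>k. \<not> P k"] by auto
      have eq: "2 * (2 * r / 2 ^ Suc m) = 2 * r / 2 ^ m" by simp
      have "2 * r / 2 ^ Suc m \<le> r" using \<open>0 < r\<close> by (simp add: field_simps)
      then have "stop x (2 * r / 2 ^ Suc m)"
        unfolding stop_def eq using m \<open>0 < r\<close> unfolding P_def not_less by simp
      then show "x \<in> X" using xE by (auto simp: X_def)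
    qed
  qed
  have "\<forall>x\<in>X. \<exists>h. stop x h" by (simp add: X_def)
  then obtain h where h: "\<And>x. x \<in> X \<Longrightarrow> stop x (h x)"
    by metis
  \<comment> \<open>The covering lemma speaks of balls. \<open>cball x (\<rho> x)\<close> contains
    \<open>ccube x (h x)\<close>, so disjoint balls make the parts of \<open>E\<close> in the chosen
    stopping cubes disjoint and their measures sum to at most that of \<open>E\<close>. In the other
    direction, the balls of radius \<open>5 * \<rho> x\<close> lie in the cubes that define
    \<open>S x\<close>.\<close>
  define \<rho> where "\<rho> x = sqrt ?n * h x" for x
  have \<rho>: "0 < \<rho> x \<and> \<rho> x \<le> sqrt ?n * r" if "x \<in> X" for x
    using h[OF that] by (auto simp: \<rho>_def stop_def)
  have "X \<subseteq> (\<Union>x\<in>X. cball x (\<rho> x))"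
    using \<rho> by (auto intro!: bexI simp: less_imp_le)
  then obtain C where C: "countable C" "C \<subseteq> X"
     "pairwise (\<lambda>x y. disjnt (cball x (\<rho> x)) (cball y (\<rho> y))) C"
     "X \<subseteq> (\<Union>x\<in>C. cball x (5 * \<rho> x))"
    using Vitali_covering_lemma_cballs[of X "\<lambda>x. x" \<rho> X "sqrt ?n * r"] \<rho> by blast
  define S where "S x = {z \<in> ccube x (5 * \<rho> x). l + K * B < \<bar>v z - c\<bar>}" for x
  have [measurable]: "S x \<in> sets borel" for x unfolding S_def by measurable
  have S_le: "emeasure lborel (S x) \<le> ennreal e * emeasure lborel (E \<inter> ccube x (h x))" if "x \<in> C" for x
  proof -
    have st: "stop x (h x)" and xE: "x \<in> E" using C that h by (auto simp: X_def)
    then have hx: "0 < h x" "h x \<le> r" by (auto simp: stop_def)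
    have "2 * h x \<le> 5 * \<rho> x"
    proof -
      have "1 * h x \<le> \<rho> x" unfolding \<rho>_def using n hx by (intro mult_right_mono) auto
      then show ?thesis using hx by linarith
    qed
    then have "emeasure lborel (S x) \<le> ennreal (2 * ((2 * (5 * \<rho> x)) ^ ?n)\<^sup>2 / (K * (2 * h x) ^ ?n))"
      unfolding S_def using st xE hx bmo \<open>0 < K\<close>
      by (intro emeasure_level_set_ccube_le[where E = E and a = a and r = r]) (auto simp: stop_def E_def)
    also have "\<dots> \<le> ennreal (e * (h x ^ ?n / 2))"
    proof (rule ennreal_leI)
      define A H T :: real where "A = (10 * sqrt ?n) ^ ?n" and "H = h x ^ ?n" and "T = 2 ^ ?n"
      have "2 * (5 * \<rho> x) = 10 * sqrt ?n * h x" by (simp add: \<rho>_def)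
      then have 1: "(2 * (5 * \<rho> x)) ^ ?n = A * H"
        unfolding A_def H_def by (metis power_mult_distrib)
      have 2: "(2 * h x) ^ ?n = T * H" unfolding T_def H_def by (rule power_mult_distrib)
      have pos: "0 < H" "1 \<le> T" using hx by (auto simp: H_def T_def)
      have "4 * A\<^sup>2 \<le> K * e" using K by (simp add: A_def)
      also have "\<dots> \<le> K * e * T" using \<open>0 < K * e\<close> pos by (simp add: mult_le_cancel_left1)
      finally have "4 * A\<^sup>2 * (H\<^sup>2 / 2) \<le> K * e * T * (H\<^sup>2 / 2)"
        by (rule mult_right_mono) simp
      then have "2 * (A * H)\<^sup>2 \<le> e * (H / 2) * (K * (T * H))"
        by (simp add: power2_eq_square algebra_simps)
      then have "2 * (A * H)\<^sup>2 / (K * (T * H)) \<le> e * (H / 2)"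
        using \<open>0 < K\<close> pos by (subst pos_divide_le_eq) auto
      then show "2 * ((2 * (5 * \<rho> x)) ^ ?n)\<^sup>2 / (K * (2 * h x) ^ ?n) \<le> e * (h x ^ ?n / 2)"
        unfolding 1 2 H_def[symmetric] .
    qed
    also have "\<dots> = ennreal e * ennreal (h x ^ ?n / 2)"
      using \<open>0 < e\<close> hx by (intro ennreal_mult) auto
    also have "\<dots> \<le> ennreal e * emeasure lborel (E \<inter> ccube x (h x))"
      using st by (intro mult_left_mono) (auto simp: stop_def)
    finally show ?thesis .
  qed
  have "emeasure lborel {x \<in> ccube a r. l + K * B < \<bar>v x - c\<bar>} \<le> emeasure lborel (\<Union>x\<in>C. S x)"
  proof (rule emeasure_mono_AE)
    show "AE x in lborel. x \<in> {x \<in> ccube a r. l + K * B < \<bar>v x - c\<bar>} \<longrightarrow> x \<in> (\<Union>x\<in>C. S x)"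
      using AE_X
    proof eventually_elim
      case (elim x)
      show ?case
      proof
        assume x: "x \<in> {x \<in> ccube a r. l + K * B < \<bar>v x - c\<bar>}"
        have "0 < K * B" using \<open>0 < K\<close> bmo by simp
        with x have "l < \<bar>v x - c\<bar>" by auto
        with x have "x \<in> E" by (auto simp: E_def)
        with elim C(4) obtain y where "y \<in> C" "x \<in> cball y (5 * \<rho> y)" by blast
        then show "x \<in> (\<Union>x\<in>C. S x)"
          using x cball_subset_ccube[of y "5 * \<rho> y"] by (auto simp: S_def)
      qed
    qed
    show "(\<Union>x\<in>C. S x) \<in> sets lborel"
      using C(1) by (intro sets.countable_UN'') auto
  qed
  also have "\<dots> \<le> (\<integral>\<^sup>+x. emeasure lborel (S x) \<partial>count_space C)"
    by (rule emeasure_UN_le_nn_integral_count_space) (use C in auto)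
  also have "\<dots> \<le> (\<integral>\<^sup>+x. ennreal e * emeasure lborel (E \<inter> ccube x (h x)) \<partial>count_space C)"
    by (rule nn_integral_mono) (use S_le in auto)
  also have "\<dots> = ennreal e * (\<integral>\<^sup>+x. emeasure lborel (E \<inter> ccube x (h x)) \<partial>count_space C)"
    by (rule nn_integral_cmult) auto
  also have "(\<integral>\<^sup>+x. emeasure lborel (E \<inter> ccube x (h x)) \<partial>count_space C) = emeasure lborel (\<Union>x\<in>C. E \<inter> ccube x (h x))"
  proof (rule emeasure_UN_countable[symmetric])
    have sub: "ccube x (h x) \<subseteq> cball x (\<rho> x)" if "x \<in> C" for x
      unfolding \<rho>_def using h[of x] C(2) that by (intro ccube_subset_cball) (auto simp: stop_def)
    show "disjoint_family_on (\<lambda>x. E \<inter> ccube x (h x)) C"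
      unfolding disjoint_family_on_def
    proof (intro ballI impI)
      fix x y assume xy: "x \<in> C" "y \<in> C" "x \<noteq> y"
      then have "cball x (\<rho> x) \<inter> cball y (\<rho> y) = {}"
        using C(3) by (auto simp: pairwise_def disjnt_def)
      then show "(E \<inter> ccube x (h x)) \<inter> (E \<inter> ccube y (h y)) = {}"
        using sub[OF xy(1)] sub[OF xy(2)] by blast
    qed
  qed (use C in auto)
  also have "\<dots> \<le> emeasure lborel E"
    by (rule emeasure_mono) auto
  finally show ?thesis
    unfolding E_def[symmetric] by (simp add: mult_left_mono)
qed

section \<open>Truncation on a single cube\<close>

lemma powr_add_le:
  fixes a b q :: real
  assumes "0 \<le> a" "0 \<le> b" "0 \<le> q"
  shows "(a + b) powr q \<le> 2 powr q * (a powr q + b powr q)"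
proof -
  have "(a + b) powr q \<le> (2 * max a b) powr q"
    using assms by (intro powr_mono2) auto
  also have "\<dots> = 2 powr q * max a b powr q"
    using assms by (simp add: powr_mult)
  also have "max a b powr q \<le> a powr q + b powr q"
    by (simp add: max_def)
  finally show ?thesis by simp
qed

lemma suminf_ennreal_cmult_geometric:
  fixes c x :: real
  assumes "0 \<le> c" "0 \<le> x" "x < 1"
  shows "(\<Sum>k. ennreal (c * x ^ k)) = ennreal (c / (1 - x))"
proof -
  have "(\<lambda>k. c * x ^ k) sums (c * (1 / (1 - x)))"
    using assms by (intro sums_mult geometric_sums) auto
  then have "(\<lambda>k. ennreal (c * x ^ k)) sums ennreal (c * (1 / (1 - x)))"
    using assms by (subst sums_ennreal) auto
  then show ?thesis by (simp add: sums_iff)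
qed

lemma ennreal_term_le_suminf: "f m \<le> (\<Sum>k. f k)" for f :: "nat \<Rightarrow> ennreal"
  using sum_le_suminf[of f "{m}"] by simp

text \<open>On the shell between \<open>2 ^ k * b\<close> and \<open>2 ^ Suc k * b\<close>,
  \<open>f powr q\<close> grows by \<open>2 powr q\<close> per step while the measure shrinks by
  \<open>2 powr (- q - 1)\<close>, which leaves a geometric series of ratio 1/2 with sum
  \<open>2 powr (q + 1)\<close>. Its leading term \<open>b powr q * |{f > b}|\<close> is already
  part of the truncated integral.\<close>

lemma nn_integral_powr_le_truncated:
  fixes f :: "'a \<Rightarrow> real"
  assumes [measurable]: "f \<in> borel_measurable M"
    and nonneg: "\<And>x. 0 \<le> f x" and "0 < b" "0 < q"
    and decay: "\<And>t. b \<le> t \<Longrightarrow> emeasure M {x \<in> space M. 2 * t < f x}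
        \<le> ennreal (2 powr (- q - 1)) * emeasure M {x \<in> space M. t < f x}"
  shows "(\<integral>\<^sup>+x. ennreal (f x powr q) \<partial>M)
    \<le> ennreal (1 + 2 powr (q + 1)) * (\<integral>\<^sup>+x. ennreal (min (f x) b powr q) \<partial>M)"
proof -
  let ?I = "\<integral>\<^sup>+x. ennreal (min (f x) b powr q) \<partial>M"
  define L where "L t = {x \<in> space M. t < f x}" for t
  have [measurable]: "L t \<in> sets M" for t unfolding L_def by measurable
  define e where "e = 2 powr (- q - 1)"
  have "0 < e" by (simp add: e_def)
  have iter: "emeasure M (L (2 ^ k * b)) \<le> ennreal (e ^ k) * emeasure M (L b)" for k
  proof (induction k)
    case (Suc k)
    have "b \<le> 2 ^ k * b" using \<open>0 < b\<close> by simp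
    then have "emeasure M (L (2 * (2 ^ k * b))) \<le> ennreal e * emeasure M (L (2 ^ k * b))"
      unfolding L_def e_def by (rule decay)
    also have "\<dots> \<le> ennreal e * (ennreal (e ^ k) * emeasure M (L b))"
      by (intro mult_left_mono Suc) simp
    also have "\<dots> = ennreal (e ^ Suc k) * emeasure M (L b)"
      using \<open>0 < e\<close> by (simp add: ennreal_mult mult.assoc)
    finally show ?case by (simp add: mult.assoc)
  qed simp
  have point: "ennreal (f x powr q) \<le> ennreal (min (f x) b powr q)
      + (\<Sum>k. ennreal ((2 ^ Suc k * b) powr q) * indicator (L (2 ^ k * b)) x)" if "x \<in> space M" for x
  proof (cases "f x \<le> b")
    case False
    obtain k :: nat where "f x / b < 2 ^ k" using real_arch_pow[of 2 "f x / b"] by auto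
    then have "f x \<le> 2 ^ k * b" using \<open>0 < b\<close> by (simp add: field_simps)
    then obtain m :: nat where m: "\<not> f x \<le> 2 ^ m * b" "f x \<le> 2 ^ Suc m * b"
      using dec_induct[of 0 k "\<lambda>k. \<not> f x \<le> 2 ^ k * b"] False by auto
    have "ennreal (f x powr q) \<le> ennreal ((2 ^ Suc m * b) powr q)"
      using m nonneg[of x] \<open>0 < q\<close> by (intro ennreal_leI powr_mono2) auto
    also have "\<dots> = ennreal ((2 ^ Suc m * b) powr q) * indicator (L (2 ^ m * b)) x"
      using m that by (simp add: L_def)
    also have "\<dots> \<le> (\<Sum>k. ennreal ((2 ^ Suc k * b) powr q) * indicator (L (2 ^ k * b)) x)"
      by (rule ennreal_term_le_suminf)
    finally show ?thesis by (rule order_trans) simp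
  qed (simp add: min_absorb1)
  have b_le: "ennreal (b powr q) * emeasure M (L b) \<le> ?I"
  proof -
    have "ennreal (b powr q) * emeasure M (L b) = (\<integral>\<^sup>+x. ennreal (b powr q) * indicator (L b) x \<partial>M)"
      by (simp add: nn_integral_cmult_indicator)
    also have "\<dots> \<le> ?I"
      by (rule nn_integral_mono) (auto simp: L_def indicator_def min_def)
    finally show ?thesis .
  qed
  have "(\<integral>\<^sup>+x. ennreal (f x powr q) \<partial>M) \<le> (\<integral>\<^sup>+x. ennreal (min (f x) b powr q)
      + (\<Sum>k. ennreal ((2 ^ Suc k * b) powr q) * indicator (L (2 ^ k * b)) x) \<partial>M)"
    by (rule nn_integral_mono) (rule point)
  also have "\<dots> = ?I + (\<integral>\<^sup>+x. (\<Sum>k. ennreal ((2 ^ Suc k * b) powr q) * indicator (L (2 ^ k * b)) x) \<partial>M)"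
    by (rule nn_integral_add) measurable
  also have "(\<integral>\<^sup>+x. (\<Sum>k. ennreal ((2 ^ Suc k * b) powr q) * indicator (L (2 ^ k * b)) x) \<partial>M)
      = (\<Sum>k. ennreal ((2 ^ Suc k * b) powr q) * emeasure M (L (2 ^ k * b)))"
    by (subst nn_integral_suminf) (auto simp: nn_integral_cmult_indicator)
  also have "\<dots> \<le> (\<Sum>k. ennreal (2 powr q * (1/2) ^ k) * (ennreal (b powr q) * emeasure M (L b)))"
  proof (rule suminf_le)
    fix k
    have "(2 ^ Suc k * b) powr q * e ^ k = 2 powr q * (1/2) ^ k * b powr q"
    proof -
      have "(2 ^ Suc k * b) powr q = 2 powr q * (2 powr q) ^ k * b powr q"
        using \<open>0 < b\<close> by (simp add: powr_mult powr_power powr_realpow[symmetric] powr_powr mult.commute)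
      moreover have "(2 powr q) ^ k * e ^ k = (1/2) ^ k"
        unfolding e_def by (simp add: power_mult_distrib[symmetric] powr_add[symmetric] powr_minus_divide)
      ultimately show ?thesis by (simp add: mult.assoc mult.left_commute)
    qed
    then have eq: "ennreal ((2 ^ Suc k * b) powr q) * ennreal (e ^ k) = ennreal (2 powr q * (1/2) ^ k) * ennreal (b powr q)"
      by (subst (1 2) ennreal_mult[symmetric]) (use \<open>0 < e\<close> in auto)
    have "ennreal ((2 ^ Suc k * b) powr q) * emeasure M (L (2 ^ k * b))
        \<le> ennreal ((2 ^ Suc k * b) powr q) * (ennreal (e ^ k) * emeasure M (L b))"
      by (intro mult_left_mono iter) simp
    also have "\<dots> = ennreal (2 powr q * (1/2) ^ k) * (ennreal (b powr q) * emeasure M (L b))"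
      unfolding mult.assoc[symmetric] eq ..
    finally show "ennreal ((2 ^ Suc k * b) powr q) * emeasure M (L (2 ^ k * b))
        \<le> ennreal (2 powr q * (1/2) ^ k) * (ennreal (b powr q) * emeasure M (L b))" .
  qed auto
  also have "\<dots> = (\<Sum>k. ennreal (2 powr q * (1/2) ^ k)) * (ennreal (b powr q) * emeasure M (L b))"
    by (rule ennreal_suminf_multc)
  also have "(\<Sum>k. ennreal (2 powr q * (1/2) ^ k)) = ennreal (2 powr (q + 1))"
    by (subst suminf_ennreal_cmult_geometric) (auto simp: powr_add)
  also have "?I + ennreal (2 powr (q + 1)) * (ennreal (b powr q) * emeasure M (L b)) \<le> ?I + ennreal (2 powr (q + 1)) * ?I"
    by (intro add_left_mono mult_left_mono b_le) simp
  also have "\<dots> = ennreal (1 + 2 powr (q + 1)) * ?I"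
    by (subst ennreal_plus) (auto simp: distrib_right)
  finally show ?thesis by simp
qed

text \<open>The \<open>K\<close> for which the size condition of \<open>good_lambda_ccube\<close> is
  an equality at \<open>e = 2 powr (- q - 1)\<close>, the decay rate that
  \<open>nn_integral_powr_le_truncated\<close> asks for.\<close>

definition good_lambda_const :: "nat \<Rightarrow> real \<Rightarrow> real" where
  "good_lambda_const n q = 4 * ((10 * sqrt n) ^ n)\<^sup>2 * 2 powr (q + 1)"

text \<open>The number 4 is what a Chebyshev estimate needs later to leave an exceptional set of at
  most half a cube.\<close>

lemma good_lambda_const_ge_4:
  assumes "0 < n" "0 < q"
  shows "4 \<le> good_lambda_const n q"
proof -
  have "1 \<le> sqrt n" using assms by simp
  then have "1 \<le> 10 * sqrt n" by linarith
  then have "1 \<le> ((10 * sqrt n) ^ n)\<^sup>2" by (intro one_le_power)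
  moreover have "1 \<le> 2 powr (q + 1)" using assms by (intro ge_one_powr_ge_zero) auto
  ultimately have "1 * 1 \<le> ((10 * sqrt n) ^ n)\<^sup>2 * 2 powr (q + 1)"
    by (intro mult_mono) auto
  then show ?thesis unfolding good_lambda_const_def by linarith
qed

lemma ccube_powr_integral_le_truncated:
  fixes v :: "real ^ 'n \<Rightarrow> real"
  assumes [measurable]: "v \<in> borel_measurable borel"
    and bmo: "bmo_bounded B v" "0 < B" and "0 < r" "0 < q" and b: "b = good_lambda_const CARD('n) q * B"
    and half: "emeasure lborel {x \<in> ccube a r. b < \<bar>v x - c\<bar>} \<le> ennreal ((2 * r) ^ CARD('n) / 2)"
  shows "(\<integral>\<^sup>+x\<in>ccube a r. ennreal (\<bar>v x - c\<bar> powr q) \<partial>lborel)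
    \<le> ennreal (1 + 2 powr (q + 1)) * (\<integral>\<^sup>+x\<in>ccube a r. ennreal (min \<bar>v x - c\<bar> b powr q) \<partial>lborel)"
proof -
  have "0 < b" unfolding b using good_lambda_const_ge_4[of "CARD('n)" q] bmo \<open>0 < q\<close> by simp
  define f where "f x = indicator (ccube a r) x * \<bar>v x - c\<bar>" for x
  have [measurable]: "f \<in> borel_measurable borel" unfolding f_def by measurable
  have L: "{x \<in> space lborel. t < f x} = {x \<in> ccube a r. t < \<bar>v x - c\<bar>}" if "0 \<le> t" for t
    using that by (auto simp: f_def indicator_def)
  have "(\<integral>\<^sup>+x. ennreal (f x powr q) \<partial>lborel)
      \<le> ennreal (1 + 2 powr (q + 1)) * (\<integral>\<^sup>+x. ennreal (min (f x) b powr q) \<partial>lborel)"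
  proof (rule nn_integral_powr_le_truncated)
    fix t assume t: "b \<le> t"
    \<comment> \<open>Because \<open>t\<close> is at least \<open>b\<close>, doubling it raises the
      level by at least \<open>good_lambda_const CARD('n) q * B\<close>. This turns the additive
      step of the good-lambda inequality into a multiplicative one.\<close>
    have "emeasure lborel {x \<in> ccube a r. 2 * t < \<bar>v x - c\<bar>}
        \<le> emeasure lborel {x \<in> ccube a r. t + good_lambda_const CARD('n) q * B < \<bar>v x - c\<bar>}"
      by (rule emeasure_mono) (use t in \<open>auto simp: b\<close>)
    also have "\<dots> \<le> ennreal (2 powr (- q - 1)) * emeasure lborel {x \<in> ccube a r. t < \<bar>v x - c\<bar>}"
    proof (rule good_lambda_ccube)
      have "2 powr (q + 1) * 2 powr (- q - 1) = (1 :: real)" by (simp add: powr_add[symmetric])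
      then show "4 * ((10 * sqrt CARD('n)) ^ CARD('n))\<^sup>2 \<le> good_lambda_const CARD('n) q * 2 powr (- q - 1)"
        unfolding good_lambda_const_def by (simp add: mult.assoc)
      have "emeasure lborel {x \<in> ccube a r. t < \<bar>v x - c\<bar>} \<le> emeasure lborel {x \<in> ccube a r. b < \<bar>v x - c\<bar>}"
        by (rule emeasure_mono) (use t in auto)
      with half show "emeasure lborel {x \<in> ccube a r. t < \<bar>v x - c\<bar>} \<le> ennreal ((2 * r) ^ CARD('n) / 2)"
        by (rule order_trans[rotated])
    qed (use assms in auto)
    finally show "emeasure lborel {x \<in> space lborel. 2 * t < f x}
        \<le> ennreal (2 powr (- q - 1)) * emeasure lborel {x \<in> space lborel. t < f x}"
      using t \<open>0 < b\<close> by (subst (1 2) L) auto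
  qed (use \<open>0 < b\<close> \<open>0 < q\<close> in \<open>auto simp: f_def\<close>)
  moreover have "ennreal (f x powr q) = ennreal (\<bar>v x - c\<bar> powr q) * indicator (ccube a r) x"
    "ennreal (min (f x) b powr q) = ennreal (min \<bar>v x - c\<bar> b powr q) * indicator (ccube a r) x" for x
    using \<open>0 < b\<close> by (auto simp: f_def indicator_def)
  ultimately show ?thesis by simp
qed

text \<open>The truncation estimate compares \<open>v\<close> with a fixed constant. So the double
  integral is first bounded by a single integral of the distance to \<open>v c\<close>, the estimate
  is applied there, and integration in \<open>c\<close> restores the second variable.\<close>

lemma ccube_powr_double_integral_le_truncated:
  fixes v :: "real ^ 'n \<Rightarrow> real"
  assumes [measurable]: "v \<in> borel_measurable borel"
    and bmo: "bmo_bounded B v" "0 < B" and r: "0 < r" and q: "0 < q" and b: "b = good_lambda_const CARD('n) q * B"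
  shows "(\<integral>\<^sup>+z\<in>ccube a r. (\<integral>\<^sup>+x\<in>ccube a r. ennreal (\<bar>v x - v z\<bar> powr q) \<partial>lborel) \<partial>lborel)
    \<le> ennreal (4 * 2 powr q * (1 + 2 powr (q + 1))) *
      (\<integral>\<^sup>+z\<in>ccube a r. (\<integral>\<^sup>+x\<in>ccube a r. ennreal (min \<bar>v x - v z\<bar> b powr q) \<partial>lborel) \<partial>lborel)"
    (is "?I \<le> _ * ?J")
proof -
  let ?Q = "ccube a r"
  define T where "T = (2 * r) ^ CARD('n)"
  have "0 < T" using r by (simp add: T_def)
  have Q: "emeasure lborel ?Q = ennreal T" using emeasure_ccube[of r a] r by (simp add: T_def)
  have K: "4 \<le> good_lambda_const CARD('n) q" using q by (simp add: good_lambda_const_ge_4)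
  have "0 < b" unfolding b using K bmo by simp
  define m where "m z = (\<integral>\<^sup>+x. indicator {x \<in> ?Q. b < \<bar>v x - v z\<bar>} x \<partial>lborel)" for z
  have m_eq: "m z = emeasure lborel {x \<in> ?Q. b < \<bar>v x - v z\<bar>}" for z
    unfolding m_def by (rule nn_integral_indicator) measurable
  have [measurable]: "m \<in> borel_measurable borel"
    unfolding m_def by measurable
  \<comment> \<open>The constants \<open>c = v z\<close> with \<open>z \<in> G\<close> satisfy the hypothesis of the one-variable estimate; averaging
    over \<open>G\<close>, which fills at least half of the cube, avoids medians.\<close>
  define G where "G = {z \<in> ?Q. m z \<le> ennreal (T / 2)}"
  have [measurable]: "G \<in> sets borel" unfolding G_def by measurable
  have G_ge: "ennreal (T / 2) \<le> emeasure lborel G"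
  proof -
    \<comment> \<open>Chebyshev: for \<open>z\<close> in the cube but outside \<open>G\<close> the
      inner integral is at least \<open>b * (T / 2)\<close>. Against the BMO bound
      \<open>B * T\<^sup>2\<close>, with \<open>b\<close> at least \<open>4 * B\<close>, this leaves
      measure at most \<open>T / 2\<close> outside \<open>G\<close>.\<close>
    have "ennreal (b * (T / 2)) * emeasure lborel (?Q - G)
        = (\<integral>\<^sup>+z\<in>?Q - G. ennreal (b * (T / 2)) \<partial>lborel)"
      by (simp add: nn_integral_cmult_indicator)
    also have "\<dots> \<le> (\<integral>\<^sup>+z\<in>?Q. (\<integral>\<^sup>+x\<in>?Q. ennreal \<bar>v x - v z\<bar> \<partial>lborel) \<partial>lborel)"
    proof (rule nn_integral_mono)
      fix z
      show "ennreal (b * (T / 2)) * indicator (?Q - G) z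
        \<le> (\<integral>\<^sup>+x\<in>?Q. ennreal \<bar>v x - v z\<bar> \<partial>lborel) * indicator ?Q z"
      proof (cases "z \<in> ?Q - G")
        case True
        then have "ennreal (T / 2) \<le> m z" by (auto simp: G_def)
        then have "ennreal (b * (T / 2)) \<le> ennreal b * m z"
          using \<open>0 < b\<close> \<open>0 < T\<close> by (subst ennreal_mult) (auto intro: mult_left_mono)
        also have "\<dots> = (\<integral>\<^sup>+x. ennreal b * indicator {x \<in> ?Q. b < \<bar>v x - v z\<bar>} x \<partial>lborel)"
          unfolding m_eq by (rule nn_integral_cmult_indicator[symmetric]) measurable
        also have "\<dots> \<le> (\<integral>\<^sup>+x\<in>?Q. ennreal \<bar>v x - v z\<bar> \<partial>lborel)"
          by (rule nn_integral_mono) (auto simp: indicator_def intro!: ennreal_leI)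
        finally show ?thesis using True by simp
      qed simp
    qed
    also have "\<dots> \<le> ennreal (B * T\<^sup>2)"
      using bmo r by (auto simp: bmo_bounded_def T_def)
    finally have *: "ennreal (b * (T / 2)) * emeasure lborel (?Q - G) \<le> ennreal (B * T\<^sup>2)" .
    have "emeasure lborel (?Q - G) \<le> ennreal T"
      unfolding Q[symmetric] by (rule emeasure_mono) auto
    then obtain s where s: "emeasure lborel (?Q - G) = ennreal s" "0 \<le> s"
      by (metis ennreal_cases ennreal_less_top infinity_ennreal_def linorder_not_less)
    have "ennreal (b * (T / 2) * s) \<le> ennreal (B * T\<^sup>2)"
      using * \<open>0 < b\<close> \<open>0 < T\<close> unfolding s(1) by (subst ennreal_mult) (use s in auto)
    then have "b * (T / 2) * s \<le> B * T\<^sup>2"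
      using bmo by (subst (asm) ennreal_le_iff) auto
    then have "(B * T) * (good_lambda_const CARD('n) q * s) \<le> (B * T) * (2 * T)"
      by (simp add: b power2_eq_square algebra_simps)
    then have "good_lambda_const CARD('n) q * s \<le> 2 * T" using bmo \<open>0 < T\<close> by simp
    moreover have "4 * s \<le> good_lambda_const CARD('n) q * s" using K s by (intro mult_right_mono)
    ultimately have "s \<le> T / 2" by linarith
    have "ennreal T \<le> emeasure lborel (G \<union> (?Q - G))"
      unfolding Q[symmetric] by (rule emeasure_mono) auto
    also have "\<dots> \<le> emeasure lborel G + emeasure lborel (?Q - G)"
      by (rule emeasure_subadditive) auto
    also have "\<dots> \<le> emeasure lborel G + ennreal (T / 2)"
      using \<open>s \<le> T / 2\<close> unfolding s(1) by (intro add_left_mono ennreal_leI)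
    finally have "ennreal (T / 2) + ennreal (T / 2) \<le> emeasure lborel G + ennreal (T / 2)"
      using \<open>0 < T\<close> by (subst ennreal_plus[symmetric]) auto
    then show ?thesis
      by (metis add.commute ennreal_add_left_cancel_le ennreal_neq_top infinity_ennreal_def)
  qed
  define g where "g c = (\<integral>\<^sup>+x\<in>?Q. ennreal (\<bar>v x - v c\<bar> powr q) \<partial>lborel)" for c
  define h where "h c = (\<integral>\<^sup>+x\<in>?Q. ennreal (min \<bar>v x - v c\<bar> b powr q) \<partial>lborel)" for c
  have [measurable]: "g \<in> borel_measurable borel" "h \<in> borel_measurable borel"
    unfolding g_def h_def by measurable
  \<comment> \<open>Both \<open>v x\<close> and \<open>v z\<close> are compared with the same
    \<open>v c\<close>. Each of the two resulting terms is constant in one variable and contributes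
    \<open>T * g c\<close>.\<close>
  have I_le: "?I \<le> ennreal (2 powr q * (2 * T)) * g c" for c
  proof -
    let ?\<phi> = "\<lambda>x. ennreal (\<bar>v x - v c\<bar> powr q)"
    have "?I \<le> (\<integral>\<^sup>+z\<in>?Q. (\<integral>\<^sup>+x\<in>?Q. ennreal (2 powr q) * (?\<phi> x + ?\<phi> z) \<partial>lborel) \<partial>lborel)"
    proof (intro nn_integral_mono mult_right_mono)
      fix x z
      have "\<bar>v x - v z\<bar> powr q \<le> (\<bar>v x - v c\<bar> + \<bar>v z - v c\<bar>) powr q"
        using q by (intro powr_mono2) auto
      also have "\<dots> \<le> 2 powr q * (\<bar>v x - v c\<bar> powr q + \<bar>v z - v c\<bar> powr q)"
        using q by (intro powr_add_le) auto
      finally show "ennreal (\<bar>v x - v z\<bar> powr q) \<le> ennreal (2 powr q) * (?\<phi> x + ?\<phi> z)"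
        by (subst ennreal_plus[symmetric], simp, simp, subst ennreal_mult[symmetric]) (auto intro: ennreal_leI)
    qed auto
    also have "\<dots> = (\<integral>\<^sup>+z\<in>?Q. ennreal (2 powr q) * (g c + ?\<phi> z * ennreal T) \<partial>lborel)"
    proof (intro nn_integral_cong arg_cong2[where f = "(*)"] refl)
      fix z
      have "(\<integral>\<^sup>+x\<in>?Q. ennreal (2 powr q) * (?\<phi> x + ?\<phi> z) \<partial>lborel)
          = (\<integral>\<^sup>+x. ennreal (2 powr q) * (?\<phi> x * indicator ?Q x + ?\<phi> z * indicator ?Q x) \<partial>lborel)"
        by (simp add: algebra_simps)
      also have "\<dots> = ennreal (2 powr q) * (g c + ?\<phi> z * ennreal T)"
        unfolding g_def
        by (subst nn_integral_cmult, measurable, subst nn_integral_add, measurable)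
           (simp add: nn_integral_cmult_indicator Q)
      finally show "(\<integral>\<^sup>+x\<in>?Q. ennreal (2 powr q) * (?\<phi> x + ?\<phi> z) \<partial>lborel)
          = ennreal (2 powr q) * (g c + ?\<phi> z * ennreal T)" .
    qed
    also have "\<dots> = (\<integral>\<^sup>+z. ennreal (2 powr q) * (g c * indicator ?Q z + ennreal T * (?\<phi> z * indicator ?Q z)) \<partial>lborel)"
      by (simp add: algebra_simps)
    also have "\<dots> = ennreal (2 powr q) * (g c * ennreal T + ennreal T * g c)"
      by (subst nn_integral_cmult, measurable, subst nn_integral_add, measurable,
          subst nn_integral_cmult, measurable) (simp add: nn_integral_cmult_indicator Q g_def)
    also have "\<dots> = ennreal (2 powr q * (2 * T)) * g c"
    proof -
      have "ennreal (2 powr q * (2 * T)) = ennreal (2 powr q) * (ennreal T + ennreal T)"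
        using \<open>0 < T\<close> by (subst ennreal_plus[symmetric]) (auto simp: ennreal_mult[symmetric])
      then show ?thesis by (simp add: algebra_simps)
    qed
    finally show ?thesis .
  qed
  let ?C = "2 powr q * (2 * T) * (1 + 2 powr (q + 1))"
  have I_le': "?I \<le> ennreal ?C * h c" if "c \<in> G" for c
  proof -
    have "g c \<le> ennreal (1 + 2 powr (q + 1)) * h c"
      unfolding g_def h_def
      by (rule ccube_powr_integral_le_truncated[OF _ bmo r q b])
         (use that in \<open>auto simp: G_def m_eq T_def\<close>)
    then have "ennreal (2 powr q * (2 * T)) * g c \<le> ennreal (2 powr q * (2 * T)) * (ennreal (1 + 2 powr (q + 1)) * h c)"
      by (rule mult_left_mono) simp
    also have "\<dots> = ennreal ?C * h c"
      using \<open>0 < T\<close> by (subst ennreal_mult[of "2 powr q * (2 * T)"]) (auto simp: mult.assoc)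
    finally show ?thesis using I_le[of c] by simp
  qed
  \<comment> \<open>The bound by \<open>h c\<close> is integrated over \<open>G\<close>. The left
    side gains at least \<open>T / 2\<close>, the right side becomes at most a multiple of
    \<open>?J\<close>, and \<open>T\<close> cancels: the constant is the same for all cubes.\<close>
  have "ennreal (T / 2) * ?I \<le> emeasure lborel G * ?I"
    by (intro mult_right_mono G_ge) simp
  also have "\<dots> = (\<integral>\<^sup>+c\<in>G. ?I \<partial>lborel)"
    by (subst nn_integral_cmult_indicator) (auto simp: mult.commute)
  also have "\<dots> \<le> (\<integral>\<^sup>+c. ennreal ?C * (h c * indicator ?Q c) \<partial>lborel)"
    by (rule nn_integral_mono) (use I_le' in \<open>auto simp: indicator_def G_def\<close>)
  also have "\<dots> = ennreal ?C * ?J"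
    unfolding h_def by (rule nn_integral_cmult) measurable
  finally have *: "ennreal (T / 2) * ?I \<le> ennreal ?C * ?J" .
  have "?I = ennreal (2 / T) * (ennreal (T / 2) * ?I)"
    using \<open>0 < T\<close> by (simp add: mult.assoc[symmetric] ennreal_mult[symmetric])
  also have "\<dots> \<le> ennreal (2 / T) * (ennreal ?C * ?J)"
    by (intro mult_left_mono *) simp
  also have "\<dots> = ennreal (2 / T * ?C) * ?J"
    using \<open>0 < T\<close> by (subst ennreal_mult[of "2 / T"]) (auto simp: mult.assoc)
  also have "2 / T * ?C = 4 * 2 powr q * (1 + 2 powr (q + 1))"
    using \<open>0 < T\<close> by simp
  finally show ?thesis .
qed

section \<open>The kernel as a superposition of cubes\<close>

lemma ccube_membership_measurable [measurable]:
  fixes f g :: "'a \<Rightarrow> real ^ 'n"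
  assumes [measurable]: "f \<in> borel_measurable M" "g \<in> borel_measurable M" "h \<in> borel_measurable M"
  shows "Measurable.pred M (\<lambda>w. f w \<in> ccube (g w) (h w))"
proof -
  have [measurable]: "(\<lambda>w. f w $ i) \<in> borel_measurable M" "(\<lambda>w. g w $ i) \<in> borel_measurable M" for i
    using assms by (auto simp: cart_eq_inner_axis)
  have "Measurable.pred M (\<lambda>w. \<forall>i\<in>UNIV. \<bar>f w $ i - g w $ i\<bar> \<le> h w)"
    by (rule pred_intros_finite) auto
  then show ?thesis by (simp add: ccube_def)
qed

lemma nn_integral_swap_pairs:
  fixes F :: "'a::euclidean_space \<times> 'b::euclidean_space \<times> 'c::euclidean_space \<times> 'd::euclidean_space \<Rightarrow> ennreal"
  assumes [measurable]: "F \<in> borel_measurable (borel \<Otimes>\<^sub>M borel \<Otimes>\<^sub>M borel \<Otimes>\<^sub>M borel)"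
  shows "(\<integral>\<^sup>+z. \<integral>\<^sup>+x. \<integral>\<^sup>+r. \<integral>\<^sup>+a. F (x, z, r, a) \<partial>lborel \<partial>lborel \<partial>lborel \<partial>lborel)
    = (\<integral>\<^sup>+r. \<integral>\<^sup>+a. \<integral>\<^sup>+z. \<integral>\<^sup>+x. F (x, z, r, a) \<partial>lborel \<partial>lborel \<partial>lborel \<partial>lborel)"
proof -
  have "(\<integral>\<^sup>+z. \<integral>\<^sup>+x. \<integral>\<^sup>+r. \<integral>\<^sup>+a. F (x, z, r, a) \<partial>lborel \<partial>lborel \<partial>lborel \<partial>lborel)
      = (\<integral>\<^sup>+z. \<integral>\<^sup>+r. \<integral>\<^sup>+x. \<integral>\<^sup>+a. F (x, z, r, a) \<partial>lborel \<partial>lborel \<partial>lborel \<partial>lborel)"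
    by (intro nn_integral_cong lborel_pair.Fubini') measurable
  also have "\<dots> = (\<integral>\<^sup>+z. \<integral>\<^sup>+r. \<integral>\<^sup>+a. \<integral>\<^sup>+x. F (x, z, r, a) \<partial>lborel \<partial>lborel \<partial>lborel \<partial>lborel)"
    by (intro nn_integral_cong lborel_pair.Fubini') measurable
  also have "\<dots> = (\<integral>\<^sup>+r. \<integral>\<^sup>+z. \<integral>\<^sup>+a. \<integral>\<^sup>+x. F (x, z, r, a) \<partial>lborel \<partial>lborel \<partial>lborel \<partial>lborel)"
    by (intro nn_integral_cong lborel_pair.Fubini') measurable
  also have "\<dots> = (\<integral>\<^sup>+r. \<integral>\<^sup>+a. \<integral>\<^sup>+z. \<integral>\<^sup>+x. F (x, z, r, a) \<partial>lborel \<partial>lborel \<partial>lborel \<partial>lborel)"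
    by (intro nn_integral_cong lborel_pair.Fubini') measurable
  finally show ?thesis .
qed

text \<open>The centres \<open>a\<close> of the cubes of radius \<open>r\<close> that contain both
  points form a set of volume comparable to \<open>r ^ CARD('n)\<close> once \<open>r\<close>
  exceeds a multiple of \<open>norm (x - z)\<close>, and no such cube exists for small
  \<open>r\<close>. The weight leaves the tail integral of \<open>r powr (- \<alpha> - 1)\<close>,
  which is comparable to \<open>norm (x - z) powr (- \<alpha>)\<close>.\<close>

definition cube_kernel :: "real \<Rightarrow> real ^ 'n \<Rightarrow> real ^ 'n \<Rightarrow> ennreal" where
  "cube_kernel \<alpha> x z = (\<integral>\<^sup>+r. \<integral>\<^sup>+a. ennreal (r powr (- real CARD('n) - \<alpha> - 1)) * indicator {0<..} r
     * indicator (ccube a r) x * indicator (ccube a r) z \<partial>lborel \<partial>lborel)"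

text \<open>Tonelli, used in both directions: an inequality between unweighted double integrals that
  holds on every cube with one constant passes to the weighted integrals over the whole
  space.\<close>

lemma nn_integral_cube_kernel:
  fixes \<Phi> :: "(real ^ 'n) \<times> (real ^ 'n) \<Rightarrow> ennreal"
  assumes [measurable]: "\<Phi> \<in> borel_measurable (borel \<Otimes>\<^sub>M borel)"
  shows "(\<integral>\<^sup>+z. \<integral>\<^sup>+x. \<Phi> (x, z) * cube_kernel \<alpha> x z \<partial>lborel \<partial>lborel)
    = (\<integral>\<^sup>+r. \<integral>\<^sup>+a. ennreal (r powr (- real CARD('n) - \<alpha> - 1)) * indicator {0<..} r
        * (\<integral>\<^sup>+z\<in>ccube a r. (\<integral>\<^sup>+x\<in>ccube a r. \<Phi> (x, z) \<partial>lborel) \<partial>lborel) \<partial>lborel \<partial>lborel)"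
proof -
  define w where "w r = ennreal (r powr (- real CARD('n) - \<alpha> - 1)) * indicator {0<..} r" for r :: real
  have [measurable]: "w \<in> borel_measurable borel" unfolding w_def by measurable
  define F :: "(real ^ 'n) \<times> (real ^ 'n) \<times> real \<times> (real ^ 'n) \<Rightarrow> ennreal" where
    "F = (\<lambda>(x, z, r, a). \<Phi> (x, z) * (w r * indicator (ccube a r) x * indicator (ccube a r) z))"
  have [measurable]: "F \<in> borel_measurable (borel \<Otimes>\<^sub>M borel \<Otimes>\<^sub>M borel \<Otimes>\<^sub>M borel)"
    unfolding F_def by measurable
  have "(\<integral>\<^sup>+z. \<integral>\<^sup>+x. \<Phi> (x, z) * cube_kernel \<alpha> x z \<partial>lborel \<partial>lborel)
      = (\<integral>\<^sup>+z. \<integral>\<^sup>+x. \<integral>\<^sup>+r. \<integral>\<^sup>+a. F (x, z, r, a) \<partial>lborel \<partial>lborel \<partial>lborel \<partial>lborel)"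
  proof (intro nn_integral_cong)
    fix x z :: "real ^ 'n"
    have "\<Phi> (x, z) * cube_kernel \<alpha> x z
        = (\<integral>\<^sup>+r. \<Phi> (x, z) * (\<integral>\<^sup>+a. w r * indicator (ccube a r) x * indicator (ccube a r) z \<partial>lborel) \<partial>lborel)"
      unfolding cube_kernel_def w_def[symmetric]
      by (rule nn_integral_cmult[symmetric]) measurable
    also have "\<dots> = (\<integral>\<^sup>+r. \<integral>\<^sup>+a. F (x, z, r, a) \<partial>lborel \<partial>lborel)"
      unfolding F_def by (intro nn_integral_cong) (simp add: nn_integral_cmult)
    finally show "\<Phi> (x, z) * cube_kernel \<alpha> x z = (\<integral>\<^sup>+r. \<integral>\<^sup>+a. F (x, z, r, a) \<partial>lborel \<partial>lborel)" .
  qed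
  also have "\<dots> = (\<integral>\<^sup>+r. \<integral>\<^sup>+a. \<integral>\<^sup>+z. \<integral>\<^sup>+x. F (x, z, r, a) \<partial>lborel \<partial>lborel \<partial>lborel \<partial>lborel)"
    by (rule nn_integral_swap_pairs) measurable
  also have "\<dots> = (\<integral>\<^sup>+r. \<integral>\<^sup>+a. w r
        * (\<integral>\<^sup>+z\<in>ccube a r. (\<integral>\<^sup>+x\<in>ccube a r. \<Phi> (x, z) \<partial>lborel) \<partial>lborel) \<partial>lborel \<partial>lborel)"
  proof (intro nn_integral_cong)
    fix r :: real and a :: "real ^ 'n"
    have "(\<integral>\<^sup>+x. F (x, z, r, a) \<partial>lborel) = w r * ((\<integral>\<^sup>+x\<in>ccube a r. \<Phi> (x, z) \<partial>lborel) * indicator (ccube a r) z)" for z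
    proof -
      have "(\<integral>\<^sup>+x. F (x, z, r, a) \<partial>lborel) = (\<integral>\<^sup>+x. (w r * indicator (ccube a r) z) * (\<Phi> (x, z) * indicator (ccube a r) x) \<partial>lborel)"
        unfolding F_def by (intro nn_integral_cong) (simp add: ac_simps)
      also have "\<dots> = (w r * indicator (ccube a r) z) * (\<integral>\<^sup>+x\<in>ccube a r. \<Phi> (x, z) \<partial>lborel)"
        by (rule nn_integral_cmult) measurable
      finally show ?thesis by (simp add: ac_simps)
    qed
    then show "(\<integral>\<^sup>+z. \<integral>\<^sup>+x. F (x, z, r, a) \<partial>lborel \<partial>lborel)
        = w r * (\<integral>\<^sup>+z\<in>ccube a r. (\<integral>\<^sup>+x\<in>ccube a r. \<Phi> (x, z) \<partial>lborel) \<partial>lborel)"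
      by (simp add: nn_integral_cmult)
  qed
  finally show ?thesis unfolding w_def .
qed

lemma nn_integral_powr_tail:
  fixes \<alpha> c :: real
  assumes "0 < \<alpha>" "0 < c"
  shows "(\<integral>\<^sup>+r. ennreal (r powr (- \<alpha> - 1)) * indicator {c..} r \<partial>lborel) = ennreal (c powr (- \<alpha>) / \<alpha>)"
proof -
  have "((\<lambda>r. r powr (- \<alpha>)) \<longlongrightarrow> 0) at_top"
    using assms by (intro tendsto_neg_powr filterlim_ident) auto
  then have lim: "((\<lambda>r. - (r powr (- \<alpha>)) / \<alpha>) \<longlongrightarrow> 0) at_top"
    using tendsto_divide[OF tendsto_minus tendsto_const[of \<alpha>]] assms by fastforce
  have "(\<integral>\<^sup>+r. ennreal (r powr (- \<alpha> - 1)) * indicator {c..} r \<partial>lborel) = ennreal (0 - (- (c powr (- \<alpha>)) / \<alpha>))"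
  proof (rule nn_integral_FTC_atLeast[OF _ _ _ lim])
    fix x assume "c \<le> x"
    with assms have "0 < x" by simp
    then show "((\<lambda>r. - (r powr (- \<alpha>)) / \<alpha>) has_real_derivative x powr (- \<alpha> - 1)) (at x)"
      using assms by (auto intro!: derivative_eq_intros)
  qed auto
  then show ?thesis by simp
qed

lemma cube_kernel_le:
  fixes x z :: "real ^ 'n"
  assumes "real CARD('n) \<le> \<alpha>" "\<alpha> \<le> real CARD('n) + p" "x \<noteq> z"
  shows "cube_kernel \<alpha> x z \<le> ennreal (2 ^ CARD('n) * (2 * sqrt CARD('n)) powr (real CARD('n) + p))
    * ennreal (1 / norm (x - z) powr \<alpha>)"
proof -
  let ?n = "CARD('n)"
  define d where "d = norm (x - z)"
  \<comment> \<open>A cube of radius \<open>r\<close> has coordinate differences at most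
    \<open>2 * r\<close>, hence Euclidean distances at most \<open>sqrt CARD('n) * (2 * r)\<close>.
    So \<open>c\<close> is a lower bound for the radius of any cube containing both points.\<close>
  define c where "c = d / (2 * sqrt ?n)"
  have "0 < d" using assms by (simp add: d_def)
  have n: "1 \<le> real ?n" "1 \<le> sqrt ?n" by auto
  have "0 < c" using \<open>0 < d\<close> n by (simp add: c_def)
  have "1 \<le> \<alpha>" using assms n by linarith
  have "cube_kernel \<alpha> x z \<le> (\<integral>\<^sup>+r. ennreal (2 ^ ?n) * (ennreal (r powr (- \<alpha> - 1)) * indicator {c..} r) \<partial>lborel)"
    unfolding cube_kernel_def
  proof (rule nn_integral_mono)
    fix r :: real
    show "(\<integral>\<^sup>+a. ennreal (r powr (- real ?n - \<alpha> - 1)) * indicator {0<..} r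
        * indicator (ccube a r) x * indicator (ccube a r) z \<partial>lborel)
      \<le> ennreal (2 ^ ?n) * (ennreal (r powr (- \<alpha> - 1)) * indicator {c..} r)"
    proof (cases "c \<le> r")
      case True
      with \<open>0 < c\<close> have "0 < r" by simp
      have "(\<integral>\<^sup>+a. ennreal (r powr (- real ?n - \<alpha> - 1)) * indicator {0<..} r
          * indicator (ccube a r) x * indicator (ccube a r) z \<partial>lborel)
        \<le> (\<integral>\<^sup>+a. ennreal (r powr (- real ?n - \<alpha> - 1)) * indicator (ccube x r) a \<partial>lborel)"
        by (rule nn_integral_mono) (auto simp: indicator_def mem_ccube_commute[of x])
      also have "\<dots> = ennreal (r powr (- real ?n - \<alpha> - 1)) * ennreal ((2 * r) ^ ?n)"
        using \<open>0 < r\<close> by (simp add: nn_integral_cmult_indicator emeasure_ccube del: power_mult_distrib)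
      also have "\<dots> = ennreal (2 ^ ?n * r powr (- \<alpha> - 1))"
      proof -
        have "r powr (- real ?n - \<alpha> - 1) * (2 * r) ^ ?n = 2 ^ ?n * (r powr (- real ?n - \<alpha> - 1) * r powr (real ?n))"
          using \<open>0 < r\<close> by (simp add: powr_realpow power_mult_distrib)
        also have "\<dots> = 2 ^ ?n * r powr (- \<alpha> - 1)"
          by (simp add: powr_add[symmetric])
        finally show ?thesis using \<open>0 < r\<close> by (subst ennreal_mult[symmetric]) auto
      qed
      also have "\<dots> = ennreal (2 ^ ?n) * ennreal (r powr (- \<alpha> - 1))"
        by (rule ennreal_mult) auto
      finally show ?thesis using True by simp
    next
      case False
      have "indicator {0<..} r * indicator (ccube a r) x * indicator (ccube a r) z = (0 :: ennreal)" for a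
      proof (rule ccontr)
        assume "indicator {0<..} r * indicator (ccube a r) x * indicator (ccube a r) z \<noteq> (0 :: ennreal)"
        then have r: "0 < r" "x \<in> ccube a r" "z \<in> ccube a r" by (auto simp: indicator_def split: if_splits)
        have "\<bar>x $ i - z $ i\<bar> \<le> 2 * r" for i
        proof -
          have "\<bar>x $ i - a $ i\<bar> \<le> r" "\<bar>z $ i - a $ i\<bar> \<le> r" using r by (auto simp: ccube_def)
          then show ?thesis by linarith
        qed
        then have "d \<le> sqrt ?n * (2 * r)"
          unfolding d_def using r by (intro norm_le_ccube) (auto simp: ccube_def)
        then have "c \<le> r" unfolding c_def using n by (subst pos_divide_le_eq) (auto simp: ac_simps)
        with False show False by simp
      qed
      then have "ennreal (r powr (- real ?n - \<alpha> - 1)) * indicator {0<..} r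
          * indicator (ccube a r) x * indicator (ccube a r) z = 0" for a
        by (metis mult.assoc mult_zero_right)
      then show ?thesis by (simp only: nn_integral_const mult_zero_left zero_le)
    qed
  qed
  also have "\<dots> = ennreal (2 ^ ?n) * ennreal (c powr (- \<alpha>) / \<alpha>)"
    using \<open>1 \<le> \<alpha>\<close> \<open>0 < c\<close> by (subst nn_integral_cmult) (auto simp: nn_integral_powr_tail)
  also have "\<dots> = ennreal (2 ^ ?n * (c powr (- \<alpha>) / \<alpha>))"
    using \<open>1 \<le> \<alpha>\<close> by (intro ennreal_mult[symmetric]) auto
  also have "\<dots> \<le> ennreal (2 ^ ?n * (2 * sqrt ?n) powr (real ?n + p) * (1 / d powr \<alpha>))"
  proof (rule ennreal_leI)
    \<comment> \<open>Here the dependence on the exponent is removed: the factor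
      \<open>1 / \<alpha>\<close> is at most 1, and the base \<open>2 * sqrt CARD('n)\<close> is at
      least 1, so its exponent may be raised to the endpoint.\<close>
    have "c powr (- \<alpha>) / \<alpha> \<le> c powr (- \<alpha>)"
      using \<open>1 \<le> \<alpha>\<close> by (simp add: divide_le_eq mult_le_cancel_left1)
    also have "\<dots> = (2 * sqrt ?n) powr \<alpha> * (1 / d powr \<alpha>)"
      unfolding c_def using \<open>0 < d\<close> n by (simp add: powr_divide powr_minus_divide)
    also have "\<dots> \<le> (2 * sqrt ?n) powr (real ?n + p) * (1 / d powr \<alpha>)"
    proof -
      have "1 \<le> 2 * sqrt ?n" using n(2) by linarith
      then show ?thesis using assms by (intro mult_right_mono powr_mono) simp_all
    qed
    finally show "2 ^ ?n * (c powr (- \<alpha>) / \<alpha>) \<le> 2 ^ ?n * (2 * sqrt ?n) powr (real ?n + p) * (1 / d powr \<alpha>)"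
      unfolding mult.assoc by (rule mult_left_mono) simp
  qed
  also have "\<dots> = ennreal (2 ^ ?n * (2 * sqrt ?n) powr (real ?n + p)) * ennreal (1 / d powr \<alpha>)"
    by (intro ennreal_mult) auto
  finally show ?thesis unfolding d_def .
qed

lemma cube_kernel_ge:
  fixes x z :: "real ^ 'n"
  assumes "real CARD('n) \<le> \<alpha>" "\<alpha> \<le> real CARD('n) + p" "x \<noteq> z"
  shows "ennreal (1 / norm (x - z) powr \<alpha>) \<le> ennreal (2 powr (real CARD('n) + p + 1)) * cube_kernel \<alpha> x z"
proof -
  let ?n = "CARD('n)"
  define d where "d = norm (x - z)"
  have "0 < d" using assms by (simp add: d_def)
  \<comment> \<open>For a lower bound it suffices to keep the radii between \<open>d\<close> and
    \<open>2 * d\<close> and the centres within \<open>r / 2\<close> of the midpoint. These cubes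
    contain both points, and the admissible centres have volume exactly
    \<open>r ^ CARD('n)\<close>.\<close>
  define m :: "real ^ 'n" where "m = (\<chi> i. (x $ i + z $ i) / 2)"
  have "ennreal (2 powr (- (real ?n + p + 1)) * (1 / d powr \<alpha>)) \<le> ennreal ((2 * d) powr (- \<alpha> - 1) * d)"
  proof (rule ennreal_leI)
    have "2 powr (- (real ?n + p + 1)) * (1 / d powr \<alpha>) \<le> 2 powr (- \<alpha> - 1) * (1 / d powr \<alpha>)"
      using assms by (intro mult_right_mono powr_mono) auto
    also have "\<dots> = (2 * d) powr (- \<alpha> - 1) * d"
      using \<open>0 < d\<close> by (simp add: powr_mult powr_diff powr_minus_divide)
    finally show "2 powr (- (real ?n + p + 1)) * (1 / d powr \<alpha>) \<le> (2 * d) powr (- \<alpha> - 1) * d" .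
  qed
  also have "\<dots> = (\<integral>\<^sup>+r. ennreal ((2 * d) powr (- \<alpha> - 1)) * indicator {d..2 * d} r \<partial>lborel)"
    using \<open>0 < d\<close> by (simp add: nn_integral_cmult_indicator ennreal_mult)
  also have "\<dots> \<le> cube_kernel \<alpha> x z"
    unfolding cube_kernel_def
  proof (rule nn_integral_mono)
    fix r :: real
    show "ennreal ((2 * d) powr (- \<alpha> - 1)) * indicator {d..2 * d} r
      \<le> (\<integral>\<^sup>+a. ennreal (r powr (- real ?n - \<alpha> - 1)) * indicator {0<..} r
        * indicator (ccube a r) x * indicator (ccube a r) z \<partial>lborel)"
    proof (cases "r \<in> {d..2 * d}")
      case True
      with \<open>0 < d\<close> have "0 < r" by simp
      have sub: "x \<in> ccube a r \<and> z \<in> ccube a r" if "a \<in> ccube m (r / 2)" for a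
      proof -
        have "\<bar>x $ i - a $ i\<bar> \<le> r \<and> \<bar>z $ i - a $ i\<bar> \<le> r" for i
        proof -
          have "\<bar>a $ i - (x $ i + z $ i) / 2\<bar> \<le> r / 2" using that by (auto simp: ccube_def m_def)
          moreover have "\<bar>x $ i - z $ i\<bar> \<le> r"
            using component_le_norm_cart[of "x - z" i] True by (simp add: d_def)
          ultimately show ?thesis by (auto simp: abs_le_iff field_simps)
        qed
        then show ?thesis by (simp add: ccube_def)
      qed
      have "(2 * d) powr (- \<alpha> - 1) \<le> r powr (- \<alpha> - 1)"
        using True \<open>0 < r\<close> assms by (intro powr_mono2') auto
      also have "\<dots> = r powr (- real ?n - \<alpha> - 1) * r powr (real ?n)"
        by (simp add: powr_add[symmetric])
      also have "\<dots> = r powr (- real ?n - \<alpha> - 1) * (2 * (r / 2)) ^ ?n"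
        using \<open>0 < r\<close> by (simp add: powr_realpow)
      finally have "ennreal ((2 * d) powr (- \<alpha> - 1)) \<le> ennreal (r powr (- real ?n - \<alpha> - 1)) * ennreal ((2 * (r / 2)) ^ ?n)"
        using \<open>0 < r\<close> by (subst ennreal_mult[symmetric]) (auto intro: ennreal_leI)
      also have "\<dots> = (\<integral>\<^sup>+a. ennreal (r powr (- real ?n - \<alpha> - 1)) * indicator (ccube m (r / 2)) a \<partial>lborel)"
        using \<open>0 < r\<close> emeasure_ccube[of "r / 2" m] by (simp add: nn_integral_cmult_indicator)
      also have "\<dots> \<le> (\<integral>\<^sup>+a. ennreal (r powr (- real ?n - \<alpha> - 1)) * indicator {0<..} r
        * indicator (ccube a r) x * indicator (ccube a r) z \<partial>lborel)"
        by (rule nn_integral_mono) (use sub \<open>0 < r\<close> in \<open>auto simp: indicator_def\<close>)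
      finally show ?thesis using True by simp
    qed simp
  qed
  finally have "ennreal (2 powr (- (real ?n + p + 1)) * (1 / d powr \<alpha>)) \<le> cube_kernel \<alpha> x z" .
  then have "ennreal (2 powr (real ?n + p + 1)) * ennreal (2 powr (- (real ?n + p + 1)) * (1 / d powr \<alpha>))
      \<le> ennreal (2 powr (real ?n + p + 1)) * cube_kernel \<alpha> x z"
    by (rule mult_left_mono) simp
  moreover have "ennreal (2 powr (real ?n + p + 1)) * ennreal (2 powr (- (real ?n + p + 1)) * (1 / d powr \<alpha>)) = ennreal (1 / d powr \<alpha>)"
  proof -
    have "2 powr (real ?n + p + 1) * (2 powr (- (real ?n + p + 1)) * (1 / d powr \<alpha>)) = 1 / d powr \<alpha>"
      unfolding mult.assoc[symmetric] powr_add[symmetric] by simp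
    then show ?thesis by (subst ennreal_mult[symmetric]) auto
  qed
  ultimately show ?thesis unfolding d_def by simp
qed

lemma cube_kernel_measurable [measurable]:
  fixes f g :: "'a \<Rightarrow> real ^ 'n"
  assumes [measurable]: "f \<in> borel_measurable M" "g \<in> borel_measurable M"
  shows "(\<lambda>w. cube_kernel \<alpha> (f w) (g w)) \<in> borel_measurable M"
  unfolding cube_kernel_def by measurable

text \<open>The factors come, in order, from the kernel lying below the superposition of cubes, from
  the comparison on one cube, and from the superposition lying below the kernel.\<close>

definition gagliardo_const :: "nat \<Rightarrow> real \<Rightarrow> real \<Rightarrow> real" where
  "gagliardo_const n p q = 2 powr (real n + p + 1) * (4 * 2 powr q * (1 + 2 powr (q + 1)))
     * (2 ^ n * (2 * sqrt n) powr (real n + p))"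

lemma gagliardo_const_pos: "0 < n \<Longrightarrow> 0 < gagliardo_const n p q"
  unfolding gagliardo_const_def by (intro mult_pos_pos add_pos_pos) auto

lemma gagliardo_integral_le_truncated:
  fixes v :: "real ^ 'n \<Rightarrow> real"
  assumes [measurable]: "v \<in> borel_measurable borel"
    and bmo: "bmo_bounded B v" "0 < B" and q: "0 < q" and b: "b = good_lambda_const CARD('n) q * B"
    and \<alpha>: "real CARD('n) \<le> \<alpha>" "\<alpha> \<le> real CARD('n) + p"
  shows "(\<integral>\<^sup>+z. \<integral>\<^sup>+x. ennreal (\<bar>v x - v z\<bar> powr q / norm (x - z) powr \<alpha>) \<partial>lborel \<partial>lborel)
    \<le> ennreal (gagliardo_const CARD('n) p q)
      * (\<integral>\<^sup>+z. \<integral>\<^sup>+x. ennreal (min \<bar>v x - v z\<bar> b powr q / norm (x - z) powr \<alpha>) \<partial>lborel \<partial>lborel)"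
proof -
  define c1 c2 c3 where "c1 = 2 powr (real CARD('n) + p + 1)" and "c2 = 4 * 2 powr q * (1 + 2 powr (q + 1))"
    and "c3 = 2 ^ CARD('n) * (2 * sqrt CARD('n)) powr (real CARD('n) + p)"
  have c: "0 \<le> c1" "0 \<le> c2" "0 \<le> c3" by (auto simp: c1_def c2_def c3_def)
  have "0 < b" unfolding b using good_lambda_const_ge_4[of "CARD('n)" q] bmo q by simp
  define \<Phi> :: "(real ^ 'n) \<times> (real ^ 'n) \<Rightarrow> ennreal" where "\<Phi> = (\<lambda>(x, z). ennreal (\<bar>v x - v z\<bar> powr q))"
  define \<Psi> :: "(real ^ 'n) \<times> (real ^ 'n) \<Rightarrow> ennreal" where "\<Psi> = (\<lambda>(x, z). ennreal (min \<bar>v x - v z\<bar> b powr q))"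
  have [measurable]: "\<Phi> \<in> borel_measurable (borel \<Otimes>\<^sub>M borel)" "\<Psi> \<in> borel_measurable (borel \<Otimes>\<^sub>M borel)"
    unfolding \<Phi>_def \<Psi>_def by measurable
  let ?w = "\<lambda>r. ennreal (r powr (- real CARD('n) - \<alpha> - 1)) * indicator {0<..} r :: ennreal"
  have "(\<integral>\<^sup>+z. \<integral>\<^sup>+x. ennreal (\<bar>v x - v z\<bar> powr q / norm (x - z) powr \<alpha>) \<partial>lborel \<partial>lborel)
      \<le> (\<integral>\<^sup>+z. \<integral>\<^sup>+x. ennreal c1 * (\<Phi> (x, z) * cube_kernel \<alpha> x z) \<partial>lborel \<partial>lborel)"
  proof (intro nn_integral_mono)
    fix x z :: "real ^ 'n"
    show "ennreal (\<bar>v x - v z\<bar> powr q / norm (x - z) powr \<alpha>) \<le> ennreal c1 * (\<Phi> (x, z) * cube_kernel \<alpha> x z)"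
    proof (cases "x = z")
      case False
      have "ennreal (\<bar>v x - v z\<bar> powr q / norm (x - z) powr \<alpha>) = \<Phi> (x, z) * ennreal (1 / norm (x - z) powr \<alpha>)"
        unfolding \<Phi>_def by (simp add: ennreal_mult[symmetric])
      also have "\<dots> \<le> \<Phi> (x, z) * (ennreal c1 * cube_kernel \<alpha> x z)"
        unfolding c1_def by (intro mult_left_mono cube_kernel_ge \<alpha> False) simp
      finally show ?thesis by (simp add: ac_simps)
    qed simp
  qed
  also have "\<dots> = ennreal c1 * (\<integral>\<^sup>+z. \<integral>\<^sup>+x. \<Phi> (x, z) * cube_kernel \<alpha> x z \<partial>lborel \<partial>lborel)"
    by (simp add: nn_integral_cmult)
  also have "(\<integral>\<^sup>+z. \<integral>\<^sup>+x. \<Phi> (x, z) * cube_kernel \<alpha> x z \<partial>lborel \<partial>lborel)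
    = (\<integral>\<^sup>+r. \<integral>\<^sup>+a. ?w r * (\<integral>\<^sup>+z\<in>ccube a r. (\<integral>\<^sup>+x\<in>ccube a r. \<Phi> (x, z) \<partial>lborel) \<partial>lborel) \<partial>lborel \<partial>lborel)"
    by (rule nn_integral_cube_kernel) measurable
  also have "\<dots> \<le> (\<integral>\<^sup>+r. \<integral>\<^sup>+a. ennreal c2 * (?w r * (\<integral>\<^sup>+z\<in>ccube a r. (\<integral>\<^sup>+x\<in>ccube a r. \<Psi> (x, z) \<partial>lborel) \<partial>lborel)) \<partial>lborel \<partial>lborel)"
  proof (intro nn_integral_mono)
    fix r :: real and a :: "real ^ 'n"
    show "?w r * (\<integral>\<^sup>+z\<in>ccube a r. (\<integral>\<^sup>+x\<in>ccube a r. \<Phi> (x, z) \<partial>lborel) \<partial>lborel)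
      \<le> ennreal c2 * (?w r * (\<integral>\<^sup>+z\<in>ccube a r. (\<integral>\<^sup>+x\<in>ccube a r. \<Psi> (x, z) \<partial>lborel) \<partial>lborel))"
    proof (cases "0 < r")
      case True
      have "(\<integral>\<^sup>+z\<in>ccube a r. (\<integral>\<^sup>+x\<in>ccube a r. \<Phi> (x, z) \<partial>lborel) \<partial>lborel)
          \<le> ennreal c2 * (\<integral>\<^sup>+z\<in>ccube a r. (\<integral>\<^sup>+x\<in>ccube a r. \<Psi> (x, z) \<partial>lborel) \<partial>lborel)"
        unfolding \<Phi>_def \<Psi>_def c2_def prod.case
        by (rule ccube_powr_double_integral_le_truncated[OF _ bmo True q b]) simp
      then have "?w r * (\<integral>\<^sup>+z\<in>ccube a r. (\<integral>\<^sup>+x\<in>ccube a r. \<Phi> (x, z) \<partial>lborel) \<partial>lborel)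
          \<le> ?w r * (ennreal c2 * (\<integral>\<^sup>+z\<in>ccube a r. (\<integral>\<^sup>+x\<in>ccube a r. \<Psi> (x, z) \<partial>lborel) \<partial>lborel))"
        by (rule mult_left_mono) simp
      then show ?thesis by (simp only: ac_simps)
    qed simp
  qed
  also have "\<dots> = ennreal c2 * (\<integral>\<^sup>+r. \<integral>\<^sup>+a. ?w r * (\<integral>\<^sup>+z\<in>ccube a r. (\<integral>\<^sup>+x\<in>ccube a r. \<Psi> (x, z) \<partial>lborel) \<partial>lborel) \<partial>lborel \<partial>lborel)"
    by (simp add: nn_integral_cmult)
  also have "(\<integral>\<^sup>+r. \<integral>\<^sup>+a. ?w r * (\<integral>\<^sup>+z\<in>ccube a r. (\<integral>\<^sup>+x\<in>ccube a r. \<Psi> (x, z) \<partial>lborel) \<partial>lborel) \<partial>lborel \<partial>lborel)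
      = (\<integral>\<^sup>+z. \<integral>\<^sup>+x. \<Psi> (x, z) * cube_kernel \<alpha> x z \<partial>lborel \<partial>lborel)"
    by (rule nn_integral_cube_kernel[symmetric]) measurable
  also have "\<dots> \<le> (\<integral>\<^sup>+z. \<integral>\<^sup>+x. ennreal c3 * ennreal (min \<bar>v x - v z\<bar> b powr q / norm (x - z) powr \<alpha>) \<partial>lborel \<partial>lborel)"
  proof (intro nn_integral_mono)
    fix x z :: "real ^ 'n"
    show "\<Psi> (x, z) * cube_kernel \<alpha> x z \<le> ennreal c3 * ennreal (min \<bar>v x - v z\<bar> b powr q / norm (x - z) powr \<alpha>)"
    proof (cases "x = z")
      \<comment> \<open>On the diagonal \<open>cube_kernel\<close> is infinite, but the truncated
        power vanishes there and the product is 0 by the convention of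
        \<open>ennreal\<close>.\<close>
      case True
      then show ?thesis using \<open>0 < b\<close> by (simp add: \<Psi>_def)
    next
      case False
      have "\<Psi> (x, z) * cube_kernel \<alpha> x z \<le> \<Psi> (x, z) * (ennreal c3 * ennreal (1 / norm (x - z) powr \<alpha>))"
        unfolding c3_def by (intro mult_left_mono cube_kernel_le \<alpha> False) simp
      also have "\<dots> = ennreal c3 * (\<Psi> (x, z) * ennreal (1 / norm (x - z) powr \<alpha>))"
        by (simp only: ac_simps)
      also have "\<Psi> (x, z) * ennreal (1 / norm (x - z) powr \<alpha>) = ennreal (min \<bar>v x - v z\<bar> b powr q / norm (x - z) powr \<alpha>)"
        unfolding \<Psi>_def by (simp add: ennreal_mult[symmetric])
      finally show ?thesis .
    qed
  qed
  also have "\<dots> = ennreal c3 * (\<integral>\<^sup>+z. \<integral>\<^sup>+x. ennreal (min \<bar>v x - v z\<bar> b powr q / norm (x - z) powr \<alpha>) \<partial>lborel \<partial>lborel)"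
    by (simp add: nn_integral_cmult)
  also have "ennreal c1 * (ennreal c2 * (ennreal c3 * (\<integral>\<^sup>+z. \<integral>\<^sup>+x. ennreal (min \<bar>v x - v z\<bar> b powr q / norm (x - z) powr \<alpha>) \<partial>lborel \<partial>lborel)))
      = ennreal (gagliardo_const CARD('n) p q) * (\<integral>\<^sup>+z. \<integral>\<^sup>+x. ennreal (min \<bar>v x - v z\<bar> b powr q / norm (x - z) powr \<alpha>) \<partial>lborel \<partial>lborel)"
    unfolding gagliardo_const_def c1_def[symmetric] c2_def[symmetric] c3_def[symmetric]
    using c by (simp add: ennreal_mult mult.assoc)
  finally show ?thesis by (simp add: mult_left_mono)
qed

section \<open>Weak-type bounds for truncated integrals, and integration over increments\<close>

definition weak_type_const :: "real \<Rightarrow> real \<Rightarrow> real" where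
  "weak_type_const p q = 2 powr p / (1 - 2 powr (p - q))"

lemma weak_type_const_pos: "p < q \<Longrightarrow> 0 < weak_type_const p q"
  unfolding weak_type_const_def using powr_less_mono[of "p - q" 0 2] by simp

text \<open>Dyadic levels below \<open>b\<close>: the power contributes \<open>2 powr (- q)\<close>
  per halving and the weak bound \<open>2 powr p\<close>, so the series has ratio
  \<open>2 powr (p - q)\<close>, below 1 exactly because p < q. The remaining
  \<open>2 powr p\<close> is the loss from using the lower end of each shell. The weight is a
  density \<open>w\<close>, so the lemma serves both pairs of points with the kernel and a single
  variable with weight 1.\<close>

lemma nn_integral_truncated_le_weak:
  fixes f :: "'a \<Rightarrow> real"
  assumes [measurable]: "f \<in> borel_measurable M" "w \<in> borel_measurable M"
    and nonneg: "\<And>x. 0 \<le> f x" and "0 < b" "0 < p" "p < q" "0 \<le> A"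
    and weak: "\<And>l. 0 < l \<Longrightarrow> (\<integral>\<^sup>+x. w x * indicator {x. l < f x} x \<partial>M) \<le> ennreal (A * l powr (- p))"
  shows "(\<integral>\<^sup>+x. ennreal (min (f x) b powr q) * w x \<partial>M) \<le> ennreal (weak_type_const p q * A * b powr (q - p))"
proof -
  have "0 < q" using assms by simp
  let ?c = "\<lambda>k::nat. ennreal ((b / 2 ^ k) powr q)"
  let ?L = "\<lambda>k::nat. {x. b / 2 ^ Suc k < f x}"
  have point: "ennreal (min (f x) b powr q) \<le> (\<Sum>k. ?c k * indicator (?L k) x)" for x
  proof (cases "f x = 0")
    case False
    with nonneg[of x] have "0 < f x" by simp
    \<comment> \<open>Index 0 absorbs all values from \<open>b\<close> upwards, since there the
      truncated function equals \<open>b\<close>.\<close>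
    have "\<exists>m. b / 2 ^ Suc m < f x \<and> min (f x) b \<le> b / 2 ^ m"
    proof -
      obtain k :: nat where "b / f x < 2 ^ k" using real_arch_pow[of 2 "b / f x"] by auto
      then have "b / 2 ^ k < min (f x) b \<or> b \<le> f x" using \<open>0 < f x\<close> \<open>0 < b\<close>
        by (auto simp: field_simps min_def)
      then show ?thesis
      proof
        assume "b / 2 ^ k < min (f x) b"
        then obtain m :: nat where "min (f x) b \<le> b / 2 ^ m" "\<not> min (f x) b \<le> b / 2 ^ Suc m"
          using dec_induct[of 0 k "\<lambda>k. min (f x) b \<le> b / 2 ^ k"] by fastforce
        then show ?thesis by (intro exI[of _ m]) auto
      next
        assume "b \<le> f x"
        with \<open>0 < b\<close> show ?thesis by (intro exI[of _ 0]) auto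
      qed
    qed
    then obtain m where m: "b / 2 ^ Suc m < f x" "min (f x) b \<le> b / 2 ^ m" by blast
    have "ennreal (min (f x) b powr q) \<le> ?c m * indicator (?L m) x"
      using m \<open>0 < f x\<close> \<open>0 < b\<close> \<open>0 < q\<close> by (auto intro!: ennreal_leI powr_mono2)
    also have "\<dots> \<le> (\<Sum>k. ?c k * indicator (?L k) x)" by (rule ennreal_term_le_suminf)
    finally show ?thesis .
  qed (use \<open>0 < b\<close> in simp)
  have "(\<integral>\<^sup>+x. ennreal (min (f x) b powr q) * w x \<partial>M) \<le> (\<integral>\<^sup>+x. (\<Sum>k. ?c k * (w x * indicator (?L k) x)) \<partial>M)"
  proof (rule nn_integral_mono)
    fix x
    have "ennreal (min (f x) b powr q) * w x \<le> (\<Sum>k. ?c k * indicator (?L k) x) * w x"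
      by (intro mult_right_mono point) simp
    also have "\<dots> = (\<Sum>k. ?c k * (w x * indicator (?L k) x))"
      by (subst ennreal_suminf_multc[symmetric]) (simp only: ac_simps)
    finally show "ennreal (min (f x) b powr q) * w x \<le> (\<Sum>k. ?c k * (w x * indicator (?L k) x))" .
  qed
  also have "\<dots> = (\<Sum>k. ?c k * (\<integral>\<^sup>+x. w x * indicator (?L k) x \<partial>M))"
    by (subst nn_integral_suminf) (auto simp: nn_integral_cmult)
  also have "\<dots> \<le> (\<Sum>k. ennreal (2 powr p * A * b powr (q - p) * (2 powr (p - q)) ^ k))"
  proof (rule suminf_le)
    fix k
    have "?c k * (\<integral>\<^sup>+x. w x * indicator (?L k) x \<partial>M) \<le> ?c k * ennreal (A * (b / 2 ^ Suc k) powr (- p))"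
      using \<open>0 < b\<close> by (intro mult_left_mono weak) auto
    also have "\<dots> = ennreal ((b / 2 ^ k) powr q * (A * (b / 2 ^ Suc k) powr (- p)))"
      using \<open>0 \<le> A\<close> by (intro ennreal_mult[symmetric]) auto
    also have "(b / 2 ^ k) powr q * (A * (b / 2 ^ Suc k) powr (- p)) = 2 powr p * A * b powr (q - p) * (2 powr (p - q)) ^ k"
    proof -
      have 1: "2 ^ k = (2::real) powr k" "2 ^ Suc k = (2::real) powr (k + 1)"
        by (auto simp: powr_realpow powr_add)
      have 2: "(b / 2 powr m) powr (- p) = b powr (- p) * 2 powr (m * p)" for m
        using \<open>0 < b\<close> by (simp add: powr_divide powr_powr powr_minus_divide)
      have x1: "(b / 2 ^ k) powr q = b powr q * 2 powr (- (k * q))"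
        unfolding 1 using \<open>0 < b\<close> by (simp add: powr_divide powr_powr powr_minus_divide)
      have x2: "(b / 2 ^ Suc k) powr (- p) = b powr (- p) * 2 powr ((k + 1) * p)"
        unfolding 1 by (rule 2)
      have x3: "b powr q * b powr (- p) = b powr (q - p)"
        by (simp add: powr_add[symmetric])
      have x4: "2 powr (- (k * q)) * 2 powr ((k + 1) * p) = 2 powr p * (2 powr (p - q)) ^ k"
        by (simp add: powr_power powr_add[symmetric] algebra_simps)
      have "(b / 2 ^ k) powr q * (A * (b / 2 ^ Suc k) powr (- p))
          = A * (b powr q * b powr (- p)) * (2 powr (- (k * q)) * 2 powr ((k + 1) * p))"
        unfolding x1 x2 by (simp only: ac_simps)
      then show ?thesis unfolding x3 x4 by (simp only: ac_simps)
    qed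
    finally show "?c k * (\<integral>\<^sup>+x. w x * indicator (?L k) x \<partial>M) \<le> ennreal (2 powr p * A * b powr (q - p) * (2 powr (p - q)) ^ k)" .
  qed auto
  also have "\<dots> = ennreal (2 powr p * A * b powr (q - p) / (1 - 2 powr (p - q)))"
    using \<open>0 \<le> A\<close> powr_less_mono[of "p - q" 0 2] \<open>p < q\<close> by (intro suminf_ennreal_cmult_geometric) auto
  also have "2 powr p * A * b powr (q - p) / (1 - 2 powr (p - q)) = weak_type_const p q * A * b powr (q - p)"
    by (simp add: weak_type_const_def)
  finally show ?thesis .
qed

lemma nn_integral_lborel_translate:
  fixes f :: "'a::euclidean_space \<Rightarrow> ennreal"
  assumes [measurable]: "f \<in> borel_measurable borel"
  shows "(\<integral>\<^sup>+x. f (c + x) \<partial>lborel) = (\<integral>\<^sup>+x. f x \<partial>lborel)"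
proof -
  have "(\<integral>\<^sup>+x. f x \<partial>lborel) = (\<integral>\<^sup>+x. f x \<partial>distr lborel borel ((+) c))"
    by (simp add: lborel_distr_plus)
  also have "\<dots> = (\<integral>\<^sup>+x. f (c + x) \<partial>lborel)"
    by (rule nn_integral_distr) auto
  finally show ?thesis by simp
qed

text \<open>The weak quasi-seminorm integrates over the increment \<open>y\<close>, the Gagliardo
  integral over pairs of points; after exchanging the order, translation invariance at fixed
  \<open>x\<close> identifies the two.\<close>

lemma nn_integral_increments:
  fixes F :: "'a::euclidean_space \<times> 'a \<Rightarrow> ennreal"
  assumes [measurable]: "F \<in> borel_measurable (borel \<Otimes>\<^sub>M borel)"
  shows "(\<integral>\<^sup>+y. \<integral>\<^sup>+x. F (x + y, x) \<partial>lborel \<partial>lborel) = (\<integral>\<^sup>+z. \<integral>\<^sup>+x. F (x, z) \<partial>lborel \<partial>lborel)"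
proof -
  have "(\<integral>\<^sup>+y. \<integral>\<^sup>+x. F (x + y, x) \<partial>lborel \<partial>lborel) = (\<integral>\<^sup>+x. \<integral>\<^sup>+y. F (x + y, x) \<partial>lborel \<partial>lborel)"
    by (rule lborel_pair.Fubini') measurable
  also have "\<dots> = (\<integral>\<^sup>+x. \<integral>\<^sup>+y. F (y, x) \<partial>lborel \<partial>lborel)"
    by (intro nn_integral_cong nn_integral_lborel_translate[where f = "\<lambda>y. F (y, _)"]) measurable
  finally show ?thesis .
qed

section \<open>Borel representatives and the norms\<close>

lemma epowr_ennreal: "0 \<le> x \<Longrightarrow> ennreal x epowr a = ennreal (x powr a)"
  by (simp add: ennreal_powr_def)

lemma epowr_top [simp]: "top epowr a = top"
  by (simp add: ennreal_powr_def)

lemma epowr_mono: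
  assumes "x \<le> y" "0 \<le> a"
  shows "x epowr a \<le> y epowr a"
proof (cases y)
  case (real r)
  with assms obtain t where "x = ennreal t" "0 \<le> t" by (cases x) (auto simp: top_unique)
  with real assms show ?thesis by (auto simp: epowr_ennreal intro!: ennreal_leI powr_mono2)
qed simp

lemma le_ennreal_powr_if_epowr_le:
  assumes "x epowr (1 / p) \<le> ennreal w" "0 < p" "0 \<le> w"
  shows "x \<le> ennreal (w powr p)"
proof (cases x)
  case (real r)
  with assms have "r powr (1 / p) \<le> w" by (simp add: epowr_ennreal)
  then have "(r powr (1 / p)) powr p \<le> w powr p" using assms by (intro powr_mono2) auto
  then show ?thesis using real assms by (simp add: powr_powr ennreal_leI)
qed (use assms in \<open>auto simp: top_unique\<close>)

lemma AE_lborel_translate: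
  fixes P :: "'a::euclidean_space \<Rightarrow> bool"
  assumes "AE x in lborel. P x"
  shows "AE x in lborel. P (x + y)"
proof -
  obtain N where N: "N \<in> null_sets lborel" "{x \<in> space lborel. \<not> P x} \<subseteq> N"
    using assms by (auto simp: eventually_ae_filter)
  then have [measurable]: "N \<in> sets borel" by auto
  have "AE x in distr lborel borel ((+) y). x \<notin> N"
    unfolding lborel_distr_plus using N(1) by (rule AE_not_in)
  then have "AE x in lborel. y + x \<notin> N"
    by (subst (asm) AE_distr_iff) auto
  then show ?thesis
    by eventually_elim (use N(2) in \<open>auto simp: add.commute\<close>)
qed

text \<open>Measurability of the set of \<open>P\<close> comes from completeness of
  \<open>lebesgue\<close>. This matters for level sets of \<open>u (x + y) - u x\<close>, where only
  the version with a Borel representative is measurable at sight.\<close>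

lemma emeasure_lebesgue_eq_lborel:
  fixes P Q :: "'a::euclidean_space \<Rightarrow> bool"
  assumes "AE x in lborel. P x \<longleftrightarrow> Q x" and Q: "{x. Q x} \<in> sets borel"
  shows "emeasure lebesgue {x. P x} = emeasure lborel {x. Q x}"
proof -
  have ae: "AE x in lebesgue. x \<in> {x. Q x} \<longleftrightarrow> x \<in> {x. P x}"
    using assms(1) by (auto simp: AE_completion_iff elim: eventually_mono)
  have Q': "{x. Q x} \<in> sets lebesgue" using Q by simp
  have "{x. P x} \<in> sets lebesgue"
    by (rule completion.in_sets_AE[OF ae Q']) simp
  then have "emeasure lebesgue {x. P x} = emeasure lebesgue {x. Q x}"
    using Q' ae by (intro emeasure_eq_AE) auto
  with Q show ?thesis by simp
qed

lemma gagliardo_norm_AE_eq: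
  fixes u v :: "real ^ 'n \<Rightarrow> real"
  assumes "AE x in lborel. u x = v x"
  shows "gagliardo_norm s q u = (\<integral>\<^sup>+z. \<integral>\<^sup>+x.
    ennreal (\<bar>v x - v z\<bar> powr q / norm (x - z) powr (s * q + real CARD('n))) \<partial>lborel \<partial>lborel) epowr (1 / q)"
proof -
  have "(\<integral>\<^sup>+z. \<integral>\<^sup>+x. ennreal (\<bar>u x - u z\<bar> powr q / norm (x - z) powr (s * q + real CARD('n))) \<partial>lborel \<partial>lborel)
      = (\<integral>\<^sup>+z. \<integral>\<^sup>+x. ennreal (\<bar>v x - v z\<bar> powr q / norm (x - z) powr (s * q + real CARD('n))) \<partial>lborel \<partial>lborel)"
  proof (rule nn_integral_cong_AE)
    show "AE z in lborel. (\<integral>\<^sup>+x. ennreal (\<bar>u x - u z\<bar> powr q / norm (x - z) powr (s * q + real CARD('n))) \<partial>lborel)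
      = (\<integral>\<^sup>+x. ennreal (\<bar>v x - v z\<bar> powr q / norm (x - z) powr (s * q + real CARD('n))) \<partial>lborel)"
      using assms
    proof eventually_elim
      case (elim z)
      show ?case by (rule nn_integral_cong_AE) (use assms elim in \<open>auto elim: eventually_mono\<close>)
    qed
  qed
  then show ?thesis unfolding gagliardo_norm_def nn_integral_completion by simp
qed

text \<open>With a Borel representative the integrand is jointly measurable, so the measure of each
  level set becomes an inner integral. The outcome uses the same pairs and the same form of kernel
  as the Gagliardo integral, which makes the two comparable pointwise.\<close>

lemma weak_gagliardo_norm_AE_eq:
  fixes u v :: "real ^ 'n \<Rightarrow> real"
  assumes ae: "AE x in lborel. u x = v x" and [measurable]: "v \<in> borel_measurable borel"
  shows "weak_gagliardo_norm s p u = (SUP t\<in>{0<..}. (\<integral>\<^sup>+z. \<integral>\<^sup>+x. ennreal t * indicator {w. t < \<bar>v w - v z\<bar> powr p} x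
    * ennreal (1 / norm (x - z) powr (s * p + real CARD('n))) \<partial>lborel \<partial>lborel) epowr (1 / p))"
proof -
  have eq: "(\<integral>\<^sup>+y. ennreal t * emeasure lebesgue {x. \<bar>u (x + y) - u x\<bar> powr p > t}
        * ennreal (1 / norm y powr (s * p + real CARD('n))) \<partial>lebesgue)
    = (\<integral>\<^sup>+z. \<integral>\<^sup>+x. ennreal t * indicator {w. t < \<bar>v w - v z\<bar> powr p} x
        * ennreal (1 / norm (x - z) powr (s * p + real CARD('n))) \<partial>lborel \<partial>lborel)" for t
  proof -
    define F :: "(real ^ 'n) \<times> (real ^ 'n) \<Rightarrow> ennreal" where
      "F = (\<lambda>(x, z). ennreal t * indicator {w. t < \<bar>v w - v z\<bar> powr p} x
        * ennreal (1 / norm (x - z) powr (s * p + real CARD('n))))"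
    have [measurable]: "F \<in> borel_measurable (borel \<Otimes>\<^sub>M borel)" unfolding F_def by measurable
    have "ennreal t * emeasure lebesgue {x. \<bar>u (x + y) - u x\<bar> powr p > t}
        * ennreal (1 / norm y powr (s * p + real CARD('n))) = (\<integral>\<^sup>+x. F (x + y, x) \<partial>lborel)" for y
    proof -
      let ?S = "{x. \<bar>v (x + y) - v x\<bar> powr p > t}"
      have "AE x in lborel. \<bar>u (x + y) - u x\<bar> powr p > t \<longleftrightarrow> \<bar>v (x + y) - v x\<bar> powr p > t"
        using ae AE_lborel_translate[OF ae, of y] by eventually_elim simp
      then have "emeasure lebesgue {x. \<bar>u (x + y) - u x\<bar> powr p > t} = emeasure lborel ?S"
        by (rule emeasure_lebesgue_eq_lborel) measurable
      then have "ennreal t * emeasure lebesgue {x. \<bar>u (x + y) - u x\<bar> powr p > t}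
          * ennreal (1 / norm y powr (s * p + real CARD('n)))
        = (\<integral>\<^sup>+x. ennreal t * ennreal (1 / norm y powr (s * p + real CARD('n))) * indicator ?S x \<partial>lborel)"
        by (subst nn_integral_cmult_indicator) (auto simp: ac_simps)
      also have "\<dots> = (\<integral>\<^sup>+x. F (x + y, x) \<partial>lborel)"
        unfolding F_def by (intro nn_integral_cong) (simp add: indicator_def)
      finally show ?thesis .
    qed
    then have "(\<integral>\<^sup>+y. ennreal t * emeasure lebesgue {x. \<bar>u (x + y) - u x\<bar> powr p > t}
        * ennreal (1 / norm y powr (s * p + real CARD('n))) \<partial>lebesgue) = (\<integral>\<^sup>+y. \<integral>\<^sup>+x. F (x + y, x) \<partial>lborel \<partial>lborel)"
      by (simp add: nn_integral_completion)
    also have "\<dots> = (\<integral>\<^sup>+z. \<integral>\<^sup>+x. F (x, z) \<partial>lborel \<partial>lborel)"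
      by (rule nn_integral_increments) measurable
    finally show ?thesis by (simp add: F_def)
  qed
  show ?thesis unfolding weak_gagliardo_norm_def eq ..
qed

lemma bmo_bounded_AE_eq:
  fixes u v :: "real ^ 'n \<Rightarrow> real"
  assumes ae: "AE x in lborel. u x = v x" and le: "BMO_norm u \<le> ennreal B" and "0 \<le> B"
  shows "bmo_bounded B v"
  unfolding bmo_bounded_def
proof (intro allI impI)
  fix a :: "real ^ 'n" and r :: real assume r: "0 < r"
  define T where "T = (2 * r) ^ CARD('n)"
  have "0 < T" using r by (simp add: T_def)
  let ?Q = "ccube a r"
  have Q: "emeasure lebesgue ?Q = ennreal T"
    using emeasure_ccube[of r a] r by (simp add: T_def)
  let ?J = "\<integral>\<^sup>+x\<in>?Q. (\<integral>\<^sup>+z\<in>?Q. ennreal \<bar>v z - v x\<bar> \<partial>lborel) \<partial>lborel"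
  have "(\<integral>\<^sup>+x\<in>?Q. (\<integral>\<^sup>+z\<in>?Q. ennreal \<bar>u z - u x\<bar> \<partial>lborel) \<partial>lborel) = ?J"
  proof (rule nn_integral_cong_AE)
    show "AE x in lborel. (\<integral>\<^sup>+z\<in>?Q. ennreal \<bar>u z - u x\<bar> \<partial>lborel) * indicator ?Q x
        = (\<integral>\<^sup>+z\<in>?Q. ennreal \<bar>v z - v x\<bar> \<partial>lborel) * indicator ?Q x"
      using ae
    proof eventually_elim
      case (elim x)
      have "(\<integral>\<^sup>+z\<in>?Q. ennreal \<bar>u z - u x\<bar> \<partial>lborel) = (\<integral>\<^sup>+z\<in>?Q. ennreal \<bar>v z - v x\<bar> \<partial>lborel)"
        by (rule nn_integral_cong_AE) (use ae elim in \<open>auto elim: eventually_mono\<close>)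
      then show ?case by simp
    qed
  qed
  moreover have "1 / (emeasure lebesgue ?Q)\<^sup>2 * (\<integral>\<^sup>+x\<in>?Q. (\<integral>\<^sup>+z\<in>?Q. ennreal \<bar>u z - u x\<bar> \<partial>lebesgue) \<partial>lebesgue)
      \<le> BMO_norm u"
    unfolding BMO_norm_def by (rule SUP_upper) (rule ccube_in_cubes[OF r])
  ultimately have "1 / (ennreal T)\<^sup>2 * ?J \<le> ennreal B"
    using le unfolding nn_integral_completion Q by simp
  also have "1 / (ennreal T)\<^sup>2 = ennreal (1 / T\<^sup>2)"
    using \<open>0 < T\<close> by (simp add: ennreal_power divide_ennreal flip: ennreal_1)
  finally have *: "ennreal (1 / T\<^sup>2) * ?J \<le> ennreal B" .
  have "?J = ennreal (T\<^sup>2) * (ennreal (1 / T\<^sup>2) * ?J)"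
    using \<open>0 < T\<close> by (simp add: mult.assoc[symmetric] ennreal_mult[symmetric])
  also have "\<dots> \<le> ennreal (T\<^sup>2) * ennreal B" by (intro mult_left_mono *) simp
  also have "\<dots> = ennreal (B * T\<^sup>2)" using \<open>0 \<le> B\<close> by (simp add: ennreal_mult[symmetric] mult.commute)
  finally show "?J \<le> ennreal (B * ((2 * r) ^ CARD('n))\<^sup>2)" unfolding T_def .
qed

section \<open>The two inequalities and membership in L^q\<close>

lemma weak_gagliardo_norm_le:
  fixes u :: "real ^ 'n \<Rightarrow> real"
  assumes u: "u \<in> borel_measurable lebesgue" and "0 < p"
  shows "weak_gagliardo_norm s p u \<le> gagliardo_norm s p u"
proof -
  obtain v where [measurable]: "v \<in> borel_measurable borel" and ae: "AE x in lborel. u x = v x"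
    using completion_ex_borel_measurable_real[OF u] by auto
  show ?thesis
    unfolding weak_gagliardo_norm_AE_eq[OF ae \<open>v \<in> borel_measurable borel\<close>] gagliardo_norm_AE_eq[OF ae]
  proof (intro SUP_least epowr_mono nn_integral_mono)
    fix t :: real and x z :: "real ^ 'n"
    assume "t \<in> {0<..}"
    \<comment> \<open>Chebyshev's inequality before integration.\<close>
    have "ennreal t * indicator {w. t < \<bar>v w - v z\<bar> powr p} x \<le> ennreal (\<bar>v x - v z\<bar> powr p)"
      by (auto simp: indicator_def intro: ennreal_leI)
    then have "ennreal t * indicator {w. t < \<bar>v w - v z\<bar> powr p} x * ennreal (1 / norm (x - z) powr (s * p + real CARD('n)))
      \<le> ennreal (\<bar>v x - v z\<bar> powr p) * ennreal (1 / norm (x - z) powr (s * p + real CARD('n)))"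
      by (rule mult_right_mono) simp
    also have "\<dots> = ennreal (\<bar>v x - v z\<bar> powr p / norm (x - z) powr (s * p + real CARD('n)))"
      by (subst ennreal_mult[symmetric]) auto
    finally show "ennreal t * indicator {w. t < \<bar>v w - v z\<bar> powr p} x * ennreal (1 / norm (x - z) powr (s * p + real CARD('n)))
      \<le> ennreal (\<bar>v x - v z\<bar> powr p / norm (x - z) powr (s * p + real CARD('n)))" .
  qed (use \<open>0 < p\<close> in auto)
qed

text \<open>With vanishing mean oscillation on every cube, \<open>v\<close> is almost everywhere
  constant on each of countably many cubes exhausting the space, hence almost everywhere constant.
  The truncation argument does not cover this case because its level would be 0.\<close>

lemma gagliardo_norm_eq_0_if_BMO_norm_eq_0:
  fixes u :: "real ^ 'n \<Rightarrow> real"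
  assumes u: "u \<in> borel_measurable lebesgue" and bmo: "BMO_norm u = 0" and "0 < q"
  shows "gagliardo_norm s q u = 0"
proof -
  obtain v where [measurable]: "v \<in> borel_measurable borel" and ae: "AE x in lborel. u x = v x"
    using completion_ex_borel_measurable_real[OF u] by auto
  have b: "bmo_bounded 0 v" using bmo by (intro bmo_bounded_AE_eq[OF ae]) auto
  have "AE z in lborel. \<forall>k::nat. z \<in> ccube 0 (Suc k) \<longrightarrow> (AE x in lborel. x \<in> ccube 0 (Suc k) \<longrightarrow> v x = v z)"
    unfolding AE_all_countable
  proof
    fix k :: nat
    have "(\<integral>\<^sup>+z\<in>ccube 0 (Suc k). (\<integral>\<^sup>+x\<in>ccube 0 (Suc k). ennreal \<bar>v x - v z\<bar> \<partial>lborel) \<partial>lborel) = 0"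
      using b[unfolded bmo_bounded_def, rule_format, of "real (Suc k)" 0] by (simp del: of_nat_Suc)
    then have "AE z in lborel. (\<integral>\<^sup>+x\<in>ccube 0 (Suc k). ennreal \<bar>v x - v z\<bar> \<partial>lborel) * indicator (ccube 0 (Suc k)) z = 0"
      by (subst (asm) nn_integral_0_iff_AE) auto
    then show "AE z in lborel. z \<in> ccube 0 (Suc k) \<longrightarrow> (AE x in lborel. x \<in> ccube 0 (Suc k) \<longrightarrow> v x = v z)"
    proof eventually_elim
      case (elim z)
      show ?case
      proof
        assume "z \<in> ccube 0 (Suc k)"
        with elim have "(\<integral>\<^sup>+x\<in>ccube 0 (Suc k). ennreal \<bar>v x - v z\<bar> \<partial>lborel) = 0" by simp
        then have "AE x in lborel. ennreal \<bar>v x - v z\<bar> * indicator (ccube 0 (Suc k)) x = 0"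
          by (subst (asm) nn_integral_0_iff_AE) auto
        then show "AE x in lborel. x \<in> ccube 0 (Suc k) \<longrightarrow> v x = v z"
          by eventually_elim auto
      qed
    qed
  qed
  then have "AE z in lborel. AE x in lborel. v x = v z"
  proof eventually_elim
    case (elim z)
    have ex: "\<exists>k. \<forall>m\<ge>k. y \<in> ccube 0 (Suc m)" for y :: "real ^ 'n"
    proof -
      obtain k :: nat where "norm y \<le> k" using real_arch_simple by blast
      then have "\<bar>y $ i\<bar> \<le> Suc m" if "k \<le> m" for i m
        using component_le_norm_cart[of y i] that by simp
      then show ?thesis by (auto simp: ccube_def)
    qed
    have "AE x in lborel. \<forall>k::nat. z \<in> ccube 0 (Suc k) \<longrightarrow> x \<in> ccube 0 (Suc k) \<longrightarrow> v x = v z"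
      unfolding AE_all_countable using elim by auto
    then show ?case
    proof eventually_elim
      case (elim x)
      \<comment> \<open>The cubes increase with the index, so the larger of the two indices gives
        one cube containing both points.\<close>
      obtain k l where "\<forall>m\<ge>k. x \<in> ccube 0 (Suc m)" "\<forall>m\<ge>l. z \<in> ccube 0 (Suc m)" using ex by metis
      then show ?case using elim[rule_format, of "max k l"] by auto
    qed
  qed
  then have "AE z in lborel. (\<integral>\<^sup>+x. ennreal (\<bar>v x - v z\<bar> powr q / norm (x - z) powr (s * q + real CARD('n))) \<partial>lborel) = 0"
  proof eventually_elim
    case (elim z)
    then show ?case by (subst nn_integral_0_iff_AE) (auto elim: eventually_mono)
  qed
  then have "(\<integral>\<^sup>+z. \<integral>\<^sup>+x. ennreal (\<bar>v x - v z\<bar> powr q / norm (x - z) powr (s * q + real CARD('n))) \<partial>lborel \<partial>lborel) = 0"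
    by (subst nn_integral_0_iff_AE) auto
  then show ?thesis
    unfolding gagliardo_norm_AE_eq[OF ae] using \<open>0 < q\<close> by (simp add: ennreal_powr_def)
qed

lemma gagliardo_norm_le_weak_BMO:
  fixes u :: "real ^ 'n \<Rightarrow> real"
  assumes u: "u \<in> BMO" and pq: "0 < p" "p < q" and s: "0 < s" "s < 1"
  shows "gagliardo_norm (p * s / q) q u
    \<le> ennreal ((gagliardo_const CARD('n) p q * weak_type_const p q * good_lambda_const CARD('n) q powr (q - p)) powr (1 / q))
      * weak_gagliardo_norm s p u epowr (p / q) * BMO_norm u epowr (1 - p / q)"
proof -
  let ?n = "CARD('n)"
  define C where "C = gagliardo_const ?n p q * weak_type_const p q * good_lambda_const ?n q powr (q - p)"
  have q: "0 < q" using pq by simp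
  have K: "4 \<le> good_lambda_const ?n q" using q by (simp add: good_lambda_const_ge_4)
  have C: "0 < C" using gagliardo_const_pos[of ?n p q] weak_type_const_pos[OF pq(2)] K by (simp add: C_def)
  have um: "u \<in> borel_measurable lebesgue" and "BMO_norm u < \<infinity>"
    using u by (auto simp: BMO_def L1_loc_def)
  then obtain B where B: "BMO_norm u = ennreal B" "0 \<le> B" by (cases "BMO_norm u") auto
  have "gagliardo_norm (p * s / q) q u
    \<le> ennreal (C powr (1 / q)) * weak_gagliardo_norm s p u epowr (p / q) * BMO_norm u epowr (1 - p / q)"
  proof (cases "B = 0")
    case True
    then show ?thesis using gagliardo_norm_eq_0_if_BMO_norm_eq_0[OF um _ q] B by simp
  next
    case False
    with B have "0 < B" by simp
    show ?thesis
    proof (cases "weak_gagliardo_norm s p u")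
      \<comment> \<open>The right-hand side is infinite because \<open>C\<close> and
        \<open>B\<close> are positive. For \<open>B = 0\<close> an infinite weak quasi-seminorm
        would instead meet a factor 0, giving 0.\<close>
      case top
      then show ?thesis
        using C \<open>0 < B\<close> B by (simp add: epowr_ennreal ennreal_mult_top ennreal_top_mult)
    next
      case (real w)
      obtain v where [measurable]: "v \<in> borel_measurable borel" and ae: "AE x in lborel. u x = v x"
        using completion_ex_borel_measurable_real[OF um] by auto
      \<comment> \<open>This is the kernel exponent of both quasi-seminorms. The estimates below use
        \<open>s\<close> only through the bounds on \<open>\<alpha>\<close>, which is why
        \<open>C\<close> does not depend on it.\<close>
      define \<alpha> where "\<alpha> = s * p + real ?n"
      have \<alpha>: "real ?n \<le> \<alpha>" "\<alpha> \<le> real ?n + p"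
        using s pq mult_right_mono[of s 1 p] by (auto simp: \<alpha>_def)
      define b where "b = good_lambda_const ?n q * B"
      have "0 < b" using K \<open>0 < B\<close> by (simp add: b_def)
      have bmo: "bmo_bounded B v" using B by (intro bmo_bounded_AE_eq[OF ae]) auto
      define A where "A = w powr p"
      define M :: "((real ^ 'n) \<times> (real ^ 'n)) measure" where "M = lborel \<Otimes>\<^sub>M lborel"
      define f :: "(real ^ 'n) \<times> (real ^ 'n) \<Rightarrow> real" where "f = (\<lambda>(x, z). \<bar>v x - v z\<bar>)"
      define k :: "(real ^ 'n) \<times> (real ^ 'n) \<Rightarrow> ennreal" where "k = (\<lambda>(x, z). ennreal (1 / norm (x - z) powr \<alpha>))"
      have [measurable]: "f \<in> borel_measurable M" "k \<in> borel_measurable M"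
        unfolding f_def k_def M_def by measurable
      have M: "(\<integral>\<^sup>+z. \<integral>\<^sup>+x. F (x, z) \<partial>lborel \<partial>lborel) = (\<integral>\<^sup>+y. F y \<partial>M)" if "F \<in> borel_measurable M" for F
        using that unfolding M_def by (rule lborel_pair.nn_integral_snd)
      have weak: "(\<integral>\<^sup>+y. k y * indicator {y. l < f y} y \<partial>M) \<le> ennreal (A * l powr (- p))" if "0 < l" for l
      proof -
        let ?I = "\<lambda>t. \<integral>\<^sup>+z. \<integral>\<^sup>+x. ennreal t * indicator {w. t < \<bar>v w - v z\<bar> powr p} x
          * ennreal (1 / norm (x - z) powr \<alpha>) \<partial>lborel \<partial>lborel"
        \<comment> \<open>The weak quasi-seminorm is stated with levels of the p-th power;
          \<open>l\<close> is the corresponding level of the difference itself.\<close>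
        define t where "t = l powr p"
        have "0 < t" using that by (simp add: t_def)
        have "?I t epowr (1 / p) \<le> weak_gagliardo_norm s p u"
          unfolding weak_gagliardo_norm_AE_eq[OF ae \<open>v \<in> borel_measurable borel\<close>] \<alpha>_def
          by (rule SUP_upper) (use \<open>0 < t\<close> in simp)
        then have "?I t \<le> ennreal A"
          unfolding A_def using real pq by (intro le_ennreal_powr_if_epowr_le) auto
        also have "?I t = (\<integral>\<^sup>+z. \<integral>\<^sup>+x. ennreal t * (k (x, z) * indicator {y. l < f y} (x, z)) \<partial>lborel \<partial>lborel)"
        proof (intro nn_integral_cong)
          fix x z
          have "t < \<bar>v x - v z\<bar> powr p \<longleftrightarrow> l < \<bar>v x - v z\<bar>"
            unfolding t_def using that pq
            by (meson abs_ge_zero less_imp_le linorder_not_less powr_less_mono2 powr_mono2)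
          then show "ennreal t * indicator {w. t < \<bar>v w - v z\<bar> powr p} x * ennreal (1 / norm (x - z) powr \<alpha>)
            = ennreal t * (k (x, z) * indicator {y. l < f y} (x, z))"
            by (simp add: indicator_def f_def k_def)
        qed
        also have "\<dots> = (\<integral>\<^sup>+y. ennreal t * (k y * indicator {y. l < f y} y) \<partial>M)"
          by (rule M) measurable
        also have "\<dots> = ennreal t * (\<integral>\<^sup>+y. k y * indicator {y. l < f y} y \<partial>M)"
          by (rule nn_integral_cmult) measurable
        finally have *: "ennreal t * (\<integral>\<^sup>+y. k y * indicator {y. l < f y} y \<partial>M) \<le> ennreal A" .
        have "(\<integral>\<^sup>+y. k y * indicator {y. l < f y} y \<partial>M)
            = ennreal (1 / t) * (ennreal t * (\<integral>\<^sup>+y. k y * indicator {y. l < f y} y \<partial>M))"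
          using \<open>0 < t\<close> by (simp add: mult.assoc[symmetric] ennreal_mult[symmetric])
        also have "\<dots> \<le> ennreal (1 / t) * ennreal A" by (intro mult_left_mono *) simp
        also have "\<dots> = ennreal (A * l powr (- p))"
          using \<open>0 < t\<close> unfolding t_def A_def
          by (subst ennreal_mult[symmetric]) (auto simp: powr_minus_divide)
        finally show ?thesis .
      qed
      have "(\<integral>\<^sup>+z. \<integral>\<^sup>+x. ennreal (\<bar>v x - v z\<bar> powr q / norm (x - z) powr \<alpha>) \<partial>lborel \<partial>lborel)
        \<le> ennreal (gagliardo_const ?n p q)
          * (\<integral>\<^sup>+z. \<integral>\<^sup>+x. ennreal (min \<bar>v x - v z\<bar> b powr q / norm (x - z) powr \<alpha>) \<partial>lborel \<partial>lborel)"
        by (rule gagliardo_integral_le_truncated[OF _ bmo \<open>0 < B\<close> q b_def \<alpha>]) simp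
      also have "(\<integral>\<^sup>+z. \<integral>\<^sup>+x. ennreal (min \<bar>v x - v z\<bar> b powr q / norm (x - z) powr \<alpha>) \<partial>lborel \<partial>lborel)
          = (\<integral>\<^sup>+z. \<integral>\<^sup>+x. ennreal (min (f (x, z)) b powr q) * k (x, z) \<partial>lborel \<partial>lborel)"
        unfolding f_def k_def by (simp add: ennreal_mult[symmetric])
      also have "\<dots> = (\<integral>\<^sup>+y. ennreal (min (f y) b powr q) * k y \<partial>M)"
        by (rule M) measurable
      also have "\<dots> \<le> ennreal (weak_type_const p q * A * b powr (q - p))"
        by (rule nn_integral_truncated_le_weak[OF _ _ _ \<open>0 < b\<close> pq _ weak])
          (measurable, auto simp: f_def A_def)
      also have "ennreal (gagliardo_const ?n p q) * ennreal (weak_type_const p q * A * b powr (q - p)) = ennreal (C * w powr p * B powr (q - p))"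
        using gagliardo_const_pos[of ?n p q] weak_type_const_pos[OF pq(2)] K \<open>0 < B\<close> unfolding A_def b_def C_def
        by (subst ennreal_mult[symmetric]) (auto simp: powr_mult ac_simps)
      finally have I: "(\<integral>\<^sup>+z. \<integral>\<^sup>+x. ennreal (\<bar>v x - v z\<bar> powr q / norm (x - z) powr \<alpha>) \<partial>lborel \<partial>lborel)
        \<le> ennreal (C * w powr p * B powr (q - p))" by (simp add: mult_left_mono)
      have "p * s / q * q + real ?n = \<alpha>" using q by (simp add: \<alpha>_def)
      then have "gagliardo_norm (p * s / q) q u
          = (\<integral>\<^sup>+z. \<integral>\<^sup>+x. ennreal (\<bar>v x - v z\<bar> powr q / norm (x - z) powr \<alpha>) \<partial>lborel \<partial>lborel) epowr (1 / q)"
        using gagliardo_norm_AE_eq[OF ae, of "p * s / q" q] by simp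
      also have "\<dots> \<le> ennreal (C * w powr p * B powr (q - p)) epowr (1 / q)"
        using q by (intro epowr_mono I) simp
      also have "\<dots> = ennreal ((C * w powr p * B powr (q - p)) powr (1 / q))"
        using C by (intro epowr_ennreal) (auto intro!: mult_nonneg_nonneg)
      also have "(C * w powr p * B powr (q - p)) powr (1 / q) = C powr (1 / q) * w powr (p / q) * B powr (1 - p / q)"
      proof -
        have "(q - p) / q = 1 - p / q" using q by (simp add: diff_divide_distrib)
        then show ?thesis using C \<open>0 < B\<close> real by (simp add: powr_mult powr_powr)
      qed
      also have "ennreal (C powr (1 / q) * w powr (p / q) * B powr (1 - p / q))
          = ennreal (C powr (1 / q)) * weak_gagliardo_norm s p u epowr (p / q) * BMO_norm u epowr (1 - p / q)"
        using real B by (simp add: epowr_ennreal ennreal_mult)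
      finally show ?thesis .
    qed
  qed
  then show ?thesis unfolding C_def .
qed

text \<open>The good-lambda argument with reference constant 0. Weak L^p makes the set where
  \<open>|v| > b\<close> of finite measure, so it fills at most half of every sufficiently large
  centred cube. The resulting bound \<open>D\<close> is independent of the cube, and monotone
  convergence gives the whole space.\<close>

lemma weak_Lp_space_BMO_in_Lp_space:
  fixes u :: "real ^ 'n \<Rightarrow> real"
  assumes u: "u \<in> BMO" "u \<in> weak_Lp_space p" and pq: "0 < p" "p < q"
  shows "u \<in> Lp_space q"
proof -
  let ?n = "CARD('n)"
  have q: "0 < q" using pq by simp
  have um: "u \<in> borel_measurable lebesgue" and "BMO_norm u < \<infinity>"
    using u by (auto simp: BMO_def L1_loc_def)
  then obtain B' where B': "BMO_norm u = ennreal B'" "0 \<le> B'" by (cases "BMO_norm u") auto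
  \<comment> \<open>Adding 1 keeps the truncation level positive when the BMO norm is 0; only
    finiteness of the final bound is at stake here.\<close>
  define B where "B = B' + 1"
  have "0 < B" using B' by (simp add: B_def)
  obtain v where [measurable]: "v \<in> borel_measurable borel" and ae: "AE x in lborel. u x = v x"
    using completion_ex_borel_measurable_real[OF um] by auto
  have bmo: "bmo_bounded B v" using B' by (intro bmo_bounded_AE_eq[OF ae]) (auto simp: B_def intro: ennreal_leI)
  define b where "b = good_lambda_const ?n q * B"
  have "0 < b" using good_lambda_const_ge_4[of ?n q] q \<open>0 < B\<close> by (simp add: b_def)
  define S where "S = (SUP t\<in>{0<..}. ennreal t * emeasure lebesgue {x. \<bar>u x\<bar> powr p > t})"
  have "S < \<infinity>" using u by (simp add: weak_Lp_space_def S_def)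
  then obtain A where A: "S = ennreal A" "0 \<le> A" by (cases S) auto
  have weak: "emeasure lborel {x. l < \<bar>v x\<bar>} \<le> ennreal (A * l powr (- p))" if "0 < l" for l
  proof -
    define t where "t = l powr p"
    have "0 < t" using that by (simp add: t_def)
    have iff: "t < \<bar>v x\<bar> powr p \<longleftrightarrow> l < \<bar>v x\<bar>" for x
      unfolding t_def using that pq
      by (meson abs_ge_zero less_imp_le linorder_not_less powr_less_mono2 powr_mono2)
    have "emeasure lebesgue {x. \<bar>u x\<bar> powr p > t} = emeasure lborel {x. l < \<bar>v x\<bar>}"
      by (rule emeasure_lebesgue_eq_lborel) (use ae iff in \<open>auto elim: eventually_mono\<close>)
    moreover have "ennreal t * emeasure lebesgue {x. \<bar>u x\<bar> powr p > t} \<le> S"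
      unfolding S_def by (rule SUP_upper) (use \<open>0 < t\<close> in simp)
    ultimately have *: "ennreal t * emeasure lborel {x. l < \<bar>v x\<bar>} \<le> ennreal A" using A by simp
    have "emeasure lborel {x. l < \<bar>v x\<bar>} = ennreal (1 / t) * (ennreal t * emeasure lborel {x. l < \<bar>v x\<bar>})"
      using \<open>0 < t\<close> by (simp add: mult.assoc[symmetric] ennreal_mult[symmetric])
    also have "\<dots> \<le> ennreal (1 / t) * ennreal A" by (intro mult_left_mono *) simp
    also have "\<dots> = ennreal (A * l powr (- p))"
      using \<open>0 < t\<close> A unfolding t_def by (subst ennreal_mult[symmetric]) (auto simp: powr_minus_divide)
    finally show ?thesis .
  qed
  define D where "D = ennreal (1 + 2 powr (q + 1)) * ennreal (weak_type_const p q * A * b powr (q - p))"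
  have min_le: "(\<integral>\<^sup>+x. ennreal (min \<bar>v x\<bar> b powr q) \<partial>lborel) \<le> ennreal (weak_type_const p q * A * b powr (q - p))"
    using nn_integral_truncated_le_weak[of "\<lambda>x. \<bar>v x\<bar>" lborel "\<lambda>_. 1", OF _ _ _ \<open>0 < b\<close> pq A(2)] weak
    by simp
  \<comment> \<open>For \<open>r\<close> at least \<open>r0\<close> the weak bound on the level set
    is at most \<open>r\<close>, which is at most half the volume of the cube because
    \<open>2 * r\<close> is at least 1.\<close>
  define r0 where "r0 = A * b powr (- p) + 1"
  have "1 \<le> r0" using A by (simp add: r0_def)
  have cube: "(\<integral>\<^sup>+x\<in>ccube 0 r. ennreal (\<bar>v x\<bar> powr q) \<partial>lborel) \<le> D" if "r0 \<le> r" for r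
  proof -
    have r: "1 \<le> r" "0 < r" using that \<open>1 \<le> r0\<close> by auto
    have "emeasure lborel {x \<in> ccube 0 r. b < \<bar>v x\<bar>} \<le> emeasure lborel {x. b < \<bar>v x\<bar>}"
      by (rule emeasure_mono) auto
    also have "\<dots> \<le> ennreal (A * b powr (- p))" by (rule weak[OF \<open>0 < b\<close>])
    also have "\<dots> \<le> ennreal ((2 * r) ^ ?n / 2)"
    proof (rule ennreal_leI)
      have "A * b powr (- p) \<le> r" using that by (simp add: r0_def)
      also have "r = (2 * r) ^ 1 / 2" by simp
      also have "\<dots> \<le> (2 * r) ^ ?n / 2"
        using r by (intro divide_right_mono power_increasing) (auto simp: Suc_le_eq)
      finally show "A * b powr (- p) \<le> (2 * r) ^ ?n / 2" .
    qed
    finally have half: "emeasure lborel {x \<in> ccube 0 r. b < \<bar>v x - 0\<bar>} \<le> ennreal ((2 * r) ^ ?n / 2)"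
      by simp
    have "(\<integral>\<^sup>+x\<in>ccube 0 r. ennreal (\<bar>v x - 0\<bar> powr q) \<partial>lborel)
        \<le> ennreal (1 + 2 powr (q + 1)) * (\<integral>\<^sup>+x\<in>ccube 0 r. ennreal (min \<bar>v x - 0\<bar> b powr q) \<partial>lborel)"
      by (rule ccube_powr_integral_le_truncated[OF _ bmo \<open>0 < B\<close> r(2) q b_def half]) simp
    also have "\<dots> \<le> ennreal (1 + 2 powr (q + 1)) * (\<integral>\<^sup>+x. ennreal (min \<bar>v x - 0\<bar> b powr q) \<partial>lborel)"
      by (intro mult_left_mono nn_integral_mono) (auto simp: indicator_def)
    also have "\<dots> \<le> D" unfolding D_def using min_le by (intro mult_left_mono) auto
    finally show ?thesis by simp
  qed
  have "(\<integral>\<^sup>+x. ennreal (\<bar>v x\<bar> powr q) \<partial>lborel)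
      = (\<integral>\<^sup>+x. (SUP k::nat. ennreal (\<bar>v x\<bar> powr q) * indicator (ccube 0 (r0 + k)) x) \<partial>lborel)"
  proof (intro nn_integral_cong antisym)
    fix x :: "real ^ 'n"
    obtain k :: nat where k: "norm x \<le> k" using real_arch_simple by blast
    have "\<bar>x $ i\<bar> \<le> r0 + k" for i
      using component_le_norm_cart[of x i] k \<open>1 \<le> r0\<close> by linarith
    then have "ennreal (\<bar>v x\<bar> powr q) = ennreal (\<bar>v x\<bar> powr q) * indicator (ccube 0 (r0 + k)) x"
      by (simp add: ccube_def)
    also have "\<dots> \<le> (SUP k::nat. ennreal (\<bar>v x\<bar> powr q) * indicator (ccube 0 (r0 + k)) x)"
      by (rule SUP_upper) simp
    finally show "ennreal (\<bar>v x\<bar> powr q) \<le> (SUP k::nat. ennreal (\<bar>v x\<bar> powr q) * indicator (ccube 0 (r0 + k)) x)" .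
    show "(SUP k::nat. ennreal (\<bar>v x\<bar> powr q) * indicator (ccube 0 (r0 + k)) x) \<le> ennreal (\<bar>v x\<bar> powr q)"
      by (rule SUP_least) (auto simp: indicator_def)
  qed
  also have "\<dots> = (SUP k::nat. \<integral>\<^sup>+x\<in>ccube 0 (r0 + k). ennreal (\<bar>v x\<bar> powr q) \<partial>lborel)"
  proof (rule nn_integral_monotone_convergence_SUP)
    show "incseq (\<lambda>k x. ennreal (\<bar>v x\<bar> powr q) * indicator (ccube 0 (r0 + real k)) x)"
    proof (intro monoI le_funI mult_left_mono)
      fix k m :: nat and x :: "real ^ 'n" assume "k \<le> m"
      then have "ccube 0 (r0 + real k) \<subseteq> ccube (0 :: real ^ 'n) (r0 + real m)" by (intro ccube_mono) simp
      then show "(indicator (ccube 0 (r0 + real k)) x :: ennreal) \<le> indicator (ccube 0 (r0 + real m)) x"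
        by (auto simp: indicator_def)
    qed simp
  qed measurable
  also have "\<dots> \<le> D" by (intro SUP_least cube) simp
  also have "D < \<infinity>" unfolding D_def by (simp add: ennreal_mult_less_top)
  finally have "(\<integral>\<^sup>+x. ennreal (\<bar>v x\<bar> powr q) \<partial>lborel) < \<infinity>" .
  moreover have "(\<integral>\<^sup>+x. ennreal (\<bar>u x\<bar> powr q) \<partial>lborel) = (\<integral>\<^sup>+x. ennreal (\<bar>v x\<bar> powr q) \<partial>lborel)"
    by (rule nn_integral_cong_AE) (use ae in \<open>auto elim: eventually_mono\<close>)
  ultimately show ?thesis
    using um by (simp add: Lp_space_def nn_integral_completion)
qed

theorem theorem1p9:
  fixes p q :: real
  assumes "0 < p" and "p < q"
  shows "(\<exists>C::real. 0 < C \<and>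
           (\<forall>s::real. 0 < s \<and> s < 1 \<longrightarrow>
             (\<forall>u :: (real ^ 'n) \<Rightarrow> real. u \<in> BMO \<longrightarrow>
                gagliardo_norm (p * s / q) q u
                  \<le> ennreal C * weak_gagliardo_norm s p u epowr (p / q) * BMO_norm u epowr (1 - p / q) \<and>
                ennreal C * weak_gagliardo_norm s p u epowr (p / q) * BMO_norm u epowr (1 - p / q)
                  \<le> ennreal C * gagliardo_norm s p u epowr (p / q) * BMO_norm u epowr (1 - p / q)))) \<and>
         (\<forall>s::real. 0 < s \<and> s < 1 \<longrightarrow>
           (\<forall>u :: (real ^ 'n) \<Rightarrow> real.
              u \<in> weak_Wsq_space s p \<inter> BMO \<longrightarrow> u \<in> Wsq_space (p * s / q) q))"
proof -
  define C where "C = (gagliardo_const CARD('n) p q * weak_type_const p q * good_lambda_const CARD('n) q powr (q - p)) powr (1 / q)"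
  have main: "gagliardo_norm (p * s / q) q u
      \<le> ennreal C * weak_gagliardo_norm s p u epowr (p / q) * BMO_norm u epowr (1 - p / q)"
    if "0 < s" "s < 1" "u \<in> BMO" for s and u :: "real ^ 'n \<Rightarrow> real"
    unfolding C_def by (rule gagliardo_norm_le_weak_BMO[OF that(3) assms that(1,2)])
  have "0 < gagliardo_const CARD('n) p q" by (rule gagliardo_const_pos) simp
  moreover have "0 < weak_type_const p q" by (rule weak_type_const_pos[OF assms(2)])
  moreover have "0 < good_lambda_const CARD('n) q" using good_lambda_const_ge_4[of "CARD('n)" q] assms by simp
  ultimately have "0 < C" by (simp add: C_def)
  moreover have "ennreal C * weak_gagliardo_norm s p u epowr (p / q) * BMO_norm u epowr (1 - p / q)
      \<le> ennreal C * gagliardo_norm s p u epowr (p / q) * BMO_norm u epowr (1 - p / q)"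
    if "u \<in> BMO" for s and u :: "real ^ 'n \<Rightarrow> real"
    using that assms
    by (intro mult_right_mono mult_left_mono epowr_mono weak_gagliardo_norm_le) (auto simp: BMO_def L1_loc_def)
  moreover have "u \<in> Wsq_space (p * s / q) q"
    if s: "0 < s" "s < 1" and u: "u \<in> weak_Wsq_space s p \<inter> BMO" for s and u :: "real ^ 'n \<Rightarrow> real"
  proof -
    have "weak_gagliardo_norm s p u < \<infinity>" "BMO_norm u < \<infinity>" "u \<in> BMO" "u \<in> weak_Lp_space p"
      using u by (auto simp: weak_Wsq_space_def BMO_def)
    then have "ennreal C * weak_gagliardo_norm s p u epowr (p / q) * BMO_norm u epowr (1 - p / q) < \<infinity>"
      by (auto simp: ennreal_powr_def ennreal_mult_less_top)
    with main[OF s \<open>u \<in> BMO\<close>] have "gagliardo_norm (p * s / q) q u < \<infinity>" by (rule le_less_trans)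
    with weak_Lp_space_BMO_in_Lp_space[OF \<open>u \<in> BMO\<close> \<open>u \<in> weak_Lp_space p\<close> assms]
    show ?thesis by (simp add: Wsq_space_def)
  qed
  ultimately show ?thesis using main by blast
qed

end
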